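(* Let $a\geq 1$ be a fixed integer. For $n>a$ (so $1\le a\le n-1$), let $\lambda_1\ge\dots\ge\lambda_n$ be the eigenvalues of $M_n(a)$ and let $\Lambda_n=\frac1n\sum_{i=1}^n\delta_{\lambda_i}$ be the empirical measure. Let $\mu_2$ be the probability measure on $\mathbb{R}$ with density $$f_2(x)=\begin{cases}\dfrac{2}{\pi(1+|x|)}\,F_{2,1}\left(\tfrac12,\tfrac12;1;\left(\dfrac{1-|x|}{1+|x|}\right)^2\right)& -1\le x\le 1,\\ 0&\text{otherwise.}\end{cases}$$ Then, as $n\to\infty$ with $a$ fixed, $d_2(\Lambda_n,\mu_2)\to0$.
   Context: $M_n(a)$ is the real symmetric $n\times n$ matrix indexed by $j,k\in\mathbb{Z}/n\mathbb{Z}$ with entries $$(M_n(a))_{j,k}=\frac14\left[\delta(j-k-1)+\delta(j-k+1)\right]+\frac12\cos\left(\frac{2\pi ak}{n}\right)\delta(j-k),$$ where $\delta(0)=1$ and $\delta(m)=0$ for $m\neq 0$ in $\mathbb{Z}/n\mathbb{Z}$. $F_{2,1}$ is the Gauss hypergeometric function $\sum_{m\ge0}\frac{(\alpha)_m(\beta)_m}{(\gamma)_m m!}z^m$ (the value of the density at $x=0$, where it is infinite, is irrelevant). $d_2$ is the Wasserstein distance: $d_2^2(\mu,\nu)=\inf E|W-Z|^2$, the infimum over all couplings $(W,Z)$ with $W\sim\mu$, $Z\sim\nu$. *)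

theory Defs
  imports
    "HOL-Probability.Probability"
    "HOL-Computational_Algebra.Computational_Algebra"
    "Jordan_Normal_Form.Char_Poly"
begin

(* The delta function on Z/mZ, evaluated at the residue class of the integer i. *)
definition delta_mod :: "nat \<Rightarrow> int \<Rightarrow> real" where
  "delta_mod m i = (if int m dvd i then 1 else 0)"

(* The indices are the representatives 0, ..., n - 1 of Z/nZ. For n = 2 both
   off-diagonal deltas fire at the same entry, and their contributions add up. *)
definition M_mat :: "nat \<Rightarrow> nat \<Rightarrow> real mat" where
  "M_mat n a = Matrix.mat n n (\<lambda>(j, k).
     1 / 4 * (delta_mod n (int j - int k - 1) + delta_mod n (int j - int k + 1))
     + 1 / 2 * cos (2 * pi * real a * real k / real n) * delta_mod n (int j - int k))"

(* Real eigenvalues in non-increasing order, repeated according to algebraic multiplicity.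
   For a real symmetric n x n matrix this list has length n. *)
definition ordered_eigenvalues :: "real mat \<Rightarrow> real list" where
  "ordered_eigenvalues A = rev (sorted_list_of_multiset (proots (char_poly A)))"

(* (1/n) * (sum of the point masses at the n eigenvalues), as the law of the eigenvalue with
   uniformly random index; the index i here is the usual one minus 1. *)
definition Lambda_emp :: "nat \<Rightarrow> nat \<Rightarrow> real measure" where
  "Lambda_emp n a =
     distr (uniform_count_measure {..<n}) borel (\<lambda>i. ordered_eigenvalues (M_mat n a) ! i)"

definition F21 :: "real \<Rightarrow> real \<Rightarrow> real \<Rightarrow> real \<Rightarrow> real" where
  "F21 \<alpha> \<beta> \<gamma> z =
     (\<Sum>m. pochhammer \<alpha> m * pochhammer \<beta> m / (pochhammer \<gamma> m * fact m) * z ^ m)"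

(* At x = 0 the series diverges and the value is an unspecified real number; this is
   a null set, so it does not affect the measure mu2. *)
definition f2 :: "real \<Rightarrow> real" where
  "f2 x = (if -1 \<le> x \<and> x \<le> 1
           then 2 / (pi * (1 + \<bar>x\<bar>)) * F21 (1 / 2) (1 / 2) 1 (((1 - \<bar>x\<bar>) / (1 + \<bar>x\<bar>)) ^ 2)
           else 0)"

definition mu2 :: "real measure" where
  "mu2 = density lborel (\<lambda>x. ennreal (f2 x))"

(* Couplings (W, Z) are represented by their joint laws on the plane. *)
definition couplings :: "real measure \<Rightarrow> real measure \<Rightarrow> (real \<times> real) measure set" where
  "couplings \<mu> \<nu> = {\<gamma>. prob_space \<gamma> \<and> sets \<gamma> = sets (borel \<Otimes>\<^sub>M borel)
      \<and> distr \<gamma> borel fst = \<mu> \<and> distr \<gamma> borel snd = \<nu>}"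

definition ennreal_sqrt :: "ennreal \<Rightarrow> ennreal" where
  "ennreal_sqrt t = (if t = \<top> then \<top> else ennreal (sqrt (enn2real t)))"

(* Valued in [0, \<infinity>]: infinite if there is no coupling, or none of finite cost. *)
definition d2 :: "real measure \<Rightarrow> real measure \<Rightarrow> ennreal" where
  "d2 \<mu> \<nu> =
     ennreal_sqrt (INF \<gamma>\<in>couplings \<mu> \<nu>. \<integral>\<^sup>+ (w, z). ennreal (\<bar>w - z\<bar> ^ 2) \<partial>\<gamma>)"

end

theory Submission
  imports Defs "Jordan_Normal_Form.Schur_Decomposition"
begin

text \<open>
  The matrix is a quantisation of the function
  \<open>(cos (2 \<pi> u) + cos (2 \<pi> v)) / 2\<close> on the torus, its symbol: the two shifts contribute the first cosine, being
  diagonal in the Fourier basis, and the diagonal contributes the second one, sampled at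
  \<open>v = a k / n\<close>. With \<open>a\<close> fixed the diagonal varies slowly, so shifts and diagonal almost commute, and
  the spectrum is distributed like the values of that function at a uniformly random point of the
  torus. In other words, the limit is the law of \<open>X + Y\<close> with \<open>X\<close> and \<open>Y\<close> independent, both
  distributed like half the sine of a uniform angle.

  To make ``almost commute'' precise, a power of the matrix is applied to a plane wave on
  \<open>\<int>/n\<int>\<close>. Up to an error \<open>k\<^sup>2 \<pi> a / n\<close>, the \<open>k\<close>-th power multiplies the wave by the
  \<open>k\<close>-th power of the symbol (\<open>M_mat_power_wave\<close>). Averaging over all waves gives the traces
  (\<open>trace_M_mat_power\<close>), that is, the moments of the empirical measure. The errors grow
  only quadratically in \<open>k\<close>, so they can be summed against the exponential series: the characteristic
  function of the empirical measure differs by \<open>O(1/n)\<close> from the average of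
  \<open>exp (i t symbol)\<close> over an \<open>n \<times> n\<close> grid (\<open>char_Lambda_emp_approx\<close>). As the symbol is a sum of a
  function of \<open>u\<close> and a function of \<open>v\<close>, this average is a product of two Riemann sums, each
  converging to the characteristic function of the law of \<open>X\<close>.

  On the other side, \<open>mu2_convolution\<close> shows that the measure with the hypergeometric density is the
  law of \<open>X + Y\<close>. In the convolution integral at \<open>x > 0\<close>, centred at \<open>x / 2\<close>, the four factors under the
  square roots regroup as
  \<open>((1 - x)\<^sup>2 - t\<^sup>2) ((1 + x)\<^sup>2 - t\<^sup>2)\<close>, and \<open>t = (1 - x) sin \<psi>\<close> turns the integral into
  \<open>2/\<pi>\<^sup>2\<close> times the integral of \<open>1 / sqrt ((1 + x)\<^sup>2 - (1 - x)\<^sup>2 sin\<^sup>2 \<psi>)\<close> over half a period. Up to a factor this is the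
  complete elliptic integral of modulus \<open>(1 - x) / (1 + x)\<close>, and the binomial series expands it into the
  hypergeometric series.

  Levy's continuity theorem turns convergence of characteristic functions into weak convergence. All
  measures live on \<open>[-1, 1]\<close>, the matrix having absolute row sums at most 1, and for uniformly bounded
  supports weak convergence implies convergence in Wasserstein distance: the almost surely convergent
  variables of Skorohod's theorem provide couplings whose cost tends to 0 by dominated convergence
  (\<open>d2_tendsto_0_of_weak_conv\<close>).
\<close>

(* The symbol $ is reserved for the entries of vectors on which matrices act: power series and
   vectors indexed by a finite type use it as well. *)
no_notation fps_nth (infixl "$" 75)
unbundle no vec_syntax

section \<open>Eigenvalues of real symmetric matrices\<close>

text \<open>
  Over the complex numbers the characteristic polynomial splits. The roots are real because, for an
  eigenvector \<open>v\<close>, the number \<open>v\<^sup>* A v\<close> is its own conjugate and equals the eigenvalue times the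
  positive number \<open>v\<^sup>* v\<close>.
\<close>
lemma symmetric_char_poly_splits:
  fixes A :: "real mat"
  assumes A: "A \<in> carrier_mat n n"
    and sym: "\<And>i j. i < n \<Longrightarrow> j < n \<Longrightarrow> A $$ (i, j) = A $$ (j, i)"
  obtains es where "length es = n" "char_poly A = (\<Prod>e\<leftarrow>es. [:- e, 1:])"
proof -
  define C where "C = map_mat complex_of_real A"
  have C: "C \<in> carrier_mat n n" using A by (simp add: C_def)
  obtain as where as: "char_poly C = (\<Prod>a\<leftarrow>as. [:- a, 1:])" "length as = n"
    using char_poly_factorized[OF C] by blast
  have real: "Im a = 0" if "a \<in> set as" for a
  proof -
    have "poly (char_poly C) a = 0"
      using that unfolding as by (auto simp: poly_prod_list prod_list_zero_iff)
    then have "eigenvalue C a" using eigenvalue_root_char_poly[OF C] by simp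
    then obtain v where v: "v \<in> carrier_vec n" "v \<noteq> 0\<^sub>v n" "C *\<^sub>v v = a \<cdot>\<^sub>v v"
      using C unfolding eigenvalue_def eigenvector_def by auto
    have Cv: "(\<Sum>j<n. of_real (A $$ (i, j)) * v $ j) = a * v $ i" if "i < n" for i
    proof -
      have "(C *\<^sub>v v) $ i = (\<Sum>j<n. C $$ (i, j) * v $ j)"
        using C v(1) that by (simp add: scalar_prod_def lessThan_atLeast0)
      also have "\<dots> = (\<Sum>j<n. of_real (A $$ (i, j)) * v $ j)"
        using A that by (intro sum.cong) (auto simp: C_def)
      finally show ?thesis using v(1,3) that by simp
    qed
    define q where "q = (\<Sum>i<n. \<Sum>j<n. of_real (A $$ (i, j)) * (cnj (v $ i) * v $ j))"
    define N where "N = (\<Sum>i<n. (cmod (v $ i))\<^sup>2)"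
    have "q = (\<Sum>i<n. cnj (v $ i) * (\<Sum>j<n. of_real (A $$ (i, j)) * v $ j))"
      unfolding q_def by (simp add: sum_distrib_left mult_ac)
    also have "\<dots> = (\<Sum>i<n. a * of_real ((cmod (v $ i))\<^sup>2))"
    proof (intro sum.cong refl)
      fix i assume "i \<in> {..<n}"
      then show "cnj (v $ i) * (\<Sum>j<n. of_real (A $$ (i, j)) * v $ j) = a * of_real ((cmod (v $ i))\<^sup>2)"
        using complex_norm_square[of "v $ i"] Cv[of i] by (simp add: mult_ac del: mult_cancel_left)
    qed
    finally have qa: "q = a * of_real N" by (simp add: N_def sum_distrib_left)
    have "cnj q = (\<Sum>i<n. \<Sum>j<n. of_real (A $$ (i, j)) * (cnj (v $ j) * v $ i))"
      unfolding q_def by (simp add: mult_ac)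
    also have "\<dots> = (\<Sum>j<n. \<Sum>i<n. of_real (A $$ (i, j)) * (cnj (v $ j) * v $ i))"
      by (rule sum.swap)
    also have "\<dots> = q"
      unfolding q_def by (intro sum.cong refl) (use sym in auto)
    finally have "Im q = 0" by (metis complex_cnj_cancel_iff complex_cnj complex.sel(2) equal_neg_zero cnj.simps(2))
    moreover have "N > 0"
    proof -
      obtain i where "i < n" "v $ i \<noteq> 0"
        using v(1,2) by (metis carrier_vecD eq_vecI index_zero_vec(1,2))
      then show ?thesis unfolding N_def
        by (intro sum_pos2[of _ i]) auto
    qed
    ultimately show ?thesis unfolding qa by simp
  qed
  have "map_poly complex_of_real (char_poly A) = char_poly C"
    unfolding C_def by (rule of_real_hom.char_poly_hom[OF A, symmetric])
  also have "\<dots> = (\<Prod>a\<leftarrow>as. [:- complex_of_real (Re a), 1:])"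
    unfolding as using real by (intro arg_cong[where f = prod_list] map_cong) (auto simp: complex_eq_iff)
  also have "\<dots> = map_poly complex_of_real (\<Prod>a\<leftarrow>map Re as. [:- a, 1:])"
  proof -
    have "map_poly complex_of_real (p * q) = map_poly of_real p * map_poly of_real q" for p q
      by (intro poly_eqI) (simp add: coeff_map_poly coeff_mult)
    then show ?thesis by (induction as) (auto simp: map_poly_pCons simp del: mult_pCons_left)
  qed
  finally have "char_poly A = (\<Prod>e\<leftarrow>map Re as. [:- e, 1:])"
    by (simp add: poly_eq_iff coeff_map_poly)
  with as(2) that[of "map Re as"] show thesis by simp
qed

lemma upper_triangular_power:
  fixes B :: "'a :: comm_semiring_1 mat"
  assumes B: "B \<in> carrier_mat n n" and ut: "upper_triangular B"
  shows "upper_triangular (B ^\<^sub>m k) \<and> (\<forall>i<n. (B ^\<^sub>m k) $$ (i, i) = (B $$ (i, i)) ^ k)"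
proof (induction k)
  case 0
  then show ?case using B by simp
next
  case (Suc k)
  have D: "B ^\<^sub>m k \<in> carrier_mat n n" using B by simp
  have ent: "(B ^\<^sub>m Suc k) $$ (i, j) = (\<Sum>l<n. (B ^\<^sub>m k) $$ (i, l) * B $$ (l, j))"
    if "i < n" "j < n" for i j
    using that B D by (simp add: scalar_prod_def lessThan_atLeast0)
  have van: "(B ^\<^sub>m k) $$ (i, l) * B $$ (l, j) = 0"
    if "i < n" "l < n" "j < n" "j < i \<or> j = i \<and> l \<noteq> i" for i j l
  proof (cases "l < i")
    case True
    then have "(B ^\<^sub>m k) $$ (i, l) = 0"
      using Suc B D that by (intro upper_triangularD) auto
    then show ?thesis by simp
  next
    case False
    then have "j < l" using that by auto
    then have "B $$ (l, j) = 0"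
      using ut B that by (intro upper_triangularD) auto
    then show ?thesis by simp
  qed
  have "upper_triangular (B ^\<^sub>m Suc k)"
  proof (rule upper_triangularI)
    fix i j assume "j < i" "i < dim_row (B ^\<^sub>m Suc k)"
    with B have "j < i" "i < n" by auto
    then show "(B ^\<^sub>m Suc k) $$ (i, j) = 0"
      using van by (subst ent) (auto intro!: sum.neutral)
  qed
  moreover have "(B ^\<^sub>m Suc k) $$ (i, i) = (B $$ (i, i)) ^ Suc k" if "i < n" for i
  proof -
    have "(B ^\<^sub>m Suc k) $$ (i, i) = (\<Sum>l\<in>{i}. (B ^\<^sub>m k) $$ (i, l) * B $$ (l, i))"
      unfolding ent[OF that that] using that van by (intro sum.mono_neutral_right) auto
    then show ?thesis using Suc that by (simp add: mult.commute)
  qed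
  ultimately show ?case by blast
qed

lemma trace_similar:
  fixes P Q B :: "'a :: comm_semiring_1 mat"
  assumes "P \<in> carrier_mat n n" "B \<in> carrier_mat n n" "Q \<in> carrier_mat n n" "Q * P = 1\<^sub>m n"
  shows "(\<Sum>i<n. (P * B * Q) $$ (i, i)) = (\<Sum>i<n. B $$ (i, i))"
proof -
  have tr: "(\<Sum>i<n. (X * Y) $$ (i, i)) = (\<Sum>i<n. (Y * X) $$ (i, i))"
    if "X \<in> carrier_mat n n" "Y \<in> carrier_mat n n" for X Y :: "'a mat"
  proof -
    have "(\<Sum>i<n. (X * Y) $$ (i, i)) = (\<Sum>i<n. \<Sum>j<n. X $$ (i, j) * Y $$ (j, i))"
      using that by (intro sum.cong) (auto simp: scalar_prod_def lessThan_atLeast0)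
    also have "\<dots> = (\<Sum>j<n. \<Sum>i<n. Y $$ (j, i) * X $$ (i, j))"
      by (subst sum.swap) (simp add: mult.commute)
    also have "\<dots> = (\<Sum>i<n. (Y * X) $$ (i, i))"
      using that by (intro sum.cong) (auto simp: scalar_prod_def lessThan_atLeast0)
    finally show ?thesis .
  qed
  have "(\<Sum>i<n. (P * B * Q) $$ (i, i)) = (\<Sum>i<n. (Q * (P * B)) $$ (i, i))"
    using assms by (intro tr) auto
  also have "Q * (P * B) = B"
    using assms by (simp flip: assoc_mult_mat[of Q n n P n B n])
  finally show ?thesis .
qed

text \<open>
  A real Schur form exists because the characteristic polynomial splits; its diagonal lists the
  eigenvalues, and powers of a triangular matrix act on the diagonal entry by entry.
\<close>
lemma ordered_eigenvalues_symmetric: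
  fixes A :: "real mat"
  assumes A: "A \<in> carrier_mat n n"
    and sym: "\<And>i j. i < n \<Longrightarrow> j < n \<Longrightarrow> A $$ (i, j) = A $$ (j, i)"
  shows "length (ordered_eigenvalues A) = n"
    and "(\<Sum>e\<leftarrow>ordered_eigenvalues A. e ^ k) = (\<Sum>i<n. (A ^\<^sub>m k) $$ (i, i))"
proof -
  obtain es where es: "length es = n" "char_poly A = (\<Prod>e\<leftarrow>es. [:- e, 1:])"
    using symmetric_char_poly_splits[OF A sym] by blast
  have "(\<Prod>e\<leftarrow>es. [:- e, 1:]) \<noteq> 0 \<and> proots (\<Prod>e\<leftarrow>es. [:- e, 1:]) = mset es" for es :: "real list"
  proof (induction es)
    case (Cons e es)
    then show ?case by (simp add: proots_mult del: mult_pCons_left)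
  qed simp
  then have "proots (char_poly A) = mset es"
    unfolding es by blast
  then have ms: "mset (ordered_eigenvalues A) = mset es"
    by (simp add: ordered_eigenvalues_def)
  show "length (ordered_eigenvalues A) = n"
    using arg_cong[OF ms, of size] es(1) by simp
  obtain B P Q where BPQ: "schur_decomposition A es = (B, P, Q)"
    by (cases "schur_decomposition A es") auto
  have wit: "similar_mat_wit A B P Q" and ut: "upper_triangular B" and diag: "diag_mat B = es"
    using schur_decomposition[OF A es(2) BPQ] by auto
  note car = similar_mat_witD2[OF A wit]
  have "(\<Sum>e\<leftarrow>ordered_eigenvalues A. e ^ k) = (\<Sum>e\<leftarrow>es. e ^ k)"
    by (metis ms mset_map sum_mset_sum_list)
  also have "\<dots> = (\<Sum>i<n. (B $$ (i, i)) ^ k)"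
    using car unfolding diag[symmetric] diag_mat_def
    by (simp add: o_def sum_list_sum_nth lessThan_atLeast0)
  also have "\<dots> = (\<Sum>i<n. (B ^\<^sub>m k) $$ (i, i))"
    using upper_triangular_power[OF _ ut] car by (intro sum.cong) auto
  also have "\<dots> = (\<Sum>i<n. (P * B ^\<^sub>m k * Q) $$ (i, i))"
    using car by (intro trace_similar[symmetric]) auto
  also have "P * B ^\<^sub>m k * Q = A ^\<^sub>m k"
    using similar_mat_wit_pow_id[OF wit] by simp
  finally show "(\<Sum>e\<leftarrow>ordered_eigenvalues A. e ^ k) = (\<Sum>i<n. (A ^\<^sub>m k) $$ (i, i))" .
qed

text \<open>
  The easy case of Gershgorin's theorem: compare both sides of \<open>A v = e v\<close> at an entry of \<open>v\<close> of
  largest absolute value.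
\<close>
lemma ordered_eigenvalues_bound:
  fixes A :: "real mat"
  assumes A: "A \<in> carrier_mat n n" and row: "\<And>i. i < n \<Longrightarrow> (\<Sum>j<n. \<bar>A $$ (i, j)\<bar>) \<le> 1"
    and e: "e \<in> set (ordered_eigenvalues A)"
  shows "\<bar>e\<bar> \<le> 1"
proof -
  have "char_poly A \<noteq> 0" using degree_monic_char_poly[OF A] by auto
  then have "poly (char_poly A) e = 0"
    using e by (simp add: ordered_eigenvalues_def)
  then have "eigenvalue A e" using eigenvalue_root_char_poly[OF A] by simp
  then obtain v where v: "v \<in> carrier_vec n" "v \<noteq> 0\<^sub>v n" "A *\<^sub>v v = e \<cdot>\<^sub>v v"
    using A unfolding eigenvalue_def eigenvector_def by auto
  obtain i0 where i0: "i0 < n" "v $ i0 \<noteq> 0"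
    using v(1,2) by (metis carrier_vecD eq_vecI index_zero_vec(1,2))
  define m where "m = Max ((\<lambda>i. \<bar>v $ i\<bar>) ` {..<n})"
  have ne: "(\<lambda>i. \<bar>v $ i\<bar>) ` {..<n} \<noteq> {}" using i0 by auto
  obtain i where i: "i < n" "\<bar>v $ i\<bar> = m"
    using Max_in[OF _ ne] unfolding m_def by auto
  have m: "\<bar>v $ j\<bar> \<le> m" if "j < n" for j
    unfolding m_def using that by (intro Max_ge) auto
  have "m > 0" using m[OF i0(1)] i0(2) by linarith
  have "e * v $ i = (\<Sum>j<n. A $$ (i, j) * v $ j)"
    using arg_cong[OF v(3), of "\<lambda>w. w $ i"] A v(1) i(1)
    by (simp add: scalar_prod_def lessThan_atLeast0)
  then have "\<bar>e\<bar> * m \<le> (\<Sum>j<n. \<bar>A $$ (i, j) * v $ j\<bar>)"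
    using i(2) by (metis abs_mult sum_abs)
  also have "\<dots> \<le> (\<Sum>j<n. \<bar>A $$ (i, j)\<bar> * m)"
    by (intro sum_mono) (auto simp: abs_mult intro!: mult_left_mono m)
  also have "\<dots> \<le> 1 * m"
    unfolding sum_distrib_right[symmetric] using row[OF i(1)] \<open>m > 0\<close> by (intro mult_right_mono) auto
  finally show ?thesis using \<open>m > 0\<close> by simp
qed

section \<open>Traces of powers of the matrix\<close>

text \<open>
  The plane wave of frequency \<open>m\<close>. Its argument is an integer rather than a residue, so that the
  neighbours \<open>x - 1\<close> and \<open>x + 1\<close> of a site need no reduction modulo \<open>n\<close>.
\<close>
definition wave :: "nat \<Rightarrow> nat \<Rightarrow> int \<Rightarrow> complex" where
  "wave n m x = cis (2 * pi * real m * of_int x / real n)"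

text \<open>
  The symbol of the matrix: on waves of frequency \<open>m\<close> with slowly varying amplitude, the matrix acts
  approximately as multiplication by this function.
\<close>
definition symb :: "nat \<Rightarrow> nat \<Rightarrow> nat \<Rightarrow> int \<Rightarrow> real" where
  "symb a n m x = (cos (2 * pi * real m / real n) + cos (2 * pi * real a * of_int x / real n)) / 2"

lemma norm_wave [simp]: "cmod (wave n m x) = 1"
  by (simp add: wave_def)

lemma Re_wave: "Re (wave n m x) = cos (2 * pi * real m * of_int x / real n)"
  by (simp add: wave_def)

lemma wave_add: "wave n m (x + y) = wave n m x * wave n m y"
  by (simp add: wave_def cis_mult add_divide_distrib ring_distribs)

lemma wave_period:
  assumes "n > 0" "int n dvd x"
  shows "wave n m x = 1"
proof -
  obtain q where "x = int n * q" using assms(2) by auto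
  then have "2 * pi * real m * of_int x / real n = 2 * pi * of_int (int m * q)"
    using assms(1) by simp
  then show ?thesis unfolding wave_def by (simp only: cis_multiple_2pi[OF Ints_of_int])
qed

lemma wave_cong:
  assumes "n > 0" "int n dvd x - y"
  shows "wave n m x = wave n m y"
  using wave_add[of n m "x - y" y] wave_period[OF assms] by simp

text \<open>
  Plane waves diagonalise the sum of the two shifts.
\<close>
lemma wave_neighbours:
  "wave n m (x - 1) + wave n m (x + 1) = 2 * of_real (cos (2 * pi * real m / real n)) * wave n m x"
proof -
  have *: "wave n m (- 1) + wave n m 1 = 2 * of_real (cos (2 * pi * real m / real n))"
    by (simp add: wave_def complex_eq_iff)
  then show ?thesis
    unfolding *[symmetric] using wave_add[of n m x 1] wave_add[of n m x "- 1"] by (simp add: algebra_simps)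
qed

lemma wave_orthogonal:
  assumes "n > 0"
  shows "(\<Sum>m<n. wave n m x) = (if int n dvd x then of_nat n else 0)"
proof (cases "int n dvd x")
  case True
  then show ?thesis using wave_period[OF assms] by simp
next
  case False
  define w where "w = wave n 1 x"
  have pw: "wave n m x = w ^ m" for m
    by (simp add: w_def wave_def Complex.DeMoivre mult_ac)
  have "w \<noteq> 1"
  proof
    assume "w = 1"
    then have "cos (2 * pi * of_int x / real n) = 1"
      by (metis Re_wave w_def one_complex.sel(1) mult.right_neutral of_nat_1)
    then obtain q :: int where "2 * pi * of_int x / real n = of_int q * 2 * pi"
      using cos_one_2pi_int by auto
    then have "real_of_int x = of_int (q * int n)"
      using assms by (simp add: field_simps)
    then have "x = q * int n" by (simp only: of_int_eq_iff)
    then show False using False by simp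
  qed
  moreover have "w ^ n = 1"
    using wave_period[OF assms, of "int n * x" 1] assms
    by (simp add: w_def wave_def Complex.DeMoivre)
  ultimately show ?thesis
    using False by (simp add: pw sum_gp_strict)
qed

text \<open>
  Exactly one representative among \<open>0, ..., n - 1\<close> is congruent to \<open>i\<close>; periodicity of \<open>f\<close> makes the
  choice of representative immaterial.
\<close>
lemma sum_delta_mod:
  fixes f :: "int \<Rightarrow> complex"
  assumes n: "n > 0" and per: "\<And>x y. int n dvd x - y \<Longrightarrow> f x = f y"
  shows "(\<Sum>r<n. of_real (delta_mod n (i - int r)) * f (int r)) = f i"
proof -
  define r0 where "r0 = nat (i mod int n)"
  have r0: "int r0 = i mod int n" "r0 < n"
    using n by (auto simp: r0_def nat_less_iff)
  have iff: "int n dvd i - int r \<longleftrightarrow> r = r0" if "r < n" for r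
  proof -
    have "int n dvd i - int r \<longleftrightarrow> i mod int n = int r mod int n"
      by (simp add: mod_eq_dvd_iff)
    then show ?thesis using that r0 by auto
  qed
  have "(\<Sum>r<n. of_real (delta_mod n (i - int r)) * f (int r)) = (\<Sum>r<n. if r = r0 then f (int r) else 0)"
    by (intro sum.cong refl) (auto simp: delta_mod_def iff)
  also have "\<dots> = f (int r0)" using r0 by simp
  also have "\<dots> = f i" using iff[OF r0(2)] per by metis
  finally show ?thesis .
qed

lemma M_mat_carrier [simp]: "M_mat n a \<in> carrier_mat n n"
  by (simp add: M_mat_def)

text \<open>
  Extending vectors to periodic functions on the integers spares a separate treatment of the
  corners of the matrix, and of the coinciding neighbours for \<open>n = 2\<close>.
\<close>
lemma M_mat_apply:
  fixes f :: "int \<Rightarrow> complex"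
  assumes j: "j < n" and per: "\<And>x y. int n dvd x - y \<Longrightarrow> f x = f y"
  shows "(\<Sum>r<n. of_real (M_mat n a $$ (j, r)) * f (int r)) =
    (f (int j - 1) + f (int j + 1)) / 4 + of_real (cos (2 * pi * real a * real j / real n)) / 2 * f (int j)"
proof -
  have n: "n > 0" using j by simp
  define g where "g x = of_real (Re (wave n a x)) * f x" for x
  have g: "g x = g y" if "int n dvd x - y" for x y
    using per[OF that] wave_cong[OF n that] by (simp add: g_def)
  have "(\<Sum>r<n. of_real (M_mat n a $$ (j, r)) * f (int r)) =
    (\<Sum>r<n. of_real (delta_mod n ((int j - 1) - int r)) * f (int r)) / 4
    + (\<Sum>r<n. of_real (delta_mod n ((int j + 1) - int r)) * f (int r)) / 4
    + (\<Sum>r<n. of_real (delta_mod n (int j - int r)) * g (int r)) / 2"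
    unfolding sum_divide_distrib sum.distrib[symmetric] using j
    by (intro sum.cong refl) (simp add: M_mat_def g_def Re_wave algebra_simps add_divide_distrib)
  also have "\<dots> = f (int j - 1) / 4 + f (int j + 1) / 4 + g (int j) / 2"
    using sum_delta_mod[OF n, of f] sum_delta_mod[OF n, of g] per g by presburger
  finally show ?thesis by (simp add: g_def Re_wave add_divide_distrib)
qed

lemma M_mat_symmetric:
  assumes "j < n" "k < n"
  shows "M_mat n a $$ (j, k) = M_mat n a $$ (k, j)"
proof -
  have neg: "delta_mod n (- i) = delta_mod n i" for i
    by (simp add: delta_mod_def)
  have "delta_mod n (int j - int k) = 0" if "j \<noteq> k"
    using that assms zdvd_not_zless by (auto simp: delta_mod_def mod_eq_dvd_iff[symmetric])
  moreover have "delta_mod n (int k - int j) = 0" if "j \<noteq> k"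
    using that assms by (auto simp: delta_mod_def mod_eq_dvd_iff[symmetric])
  ultimately have "cos (2 * pi * real a * real k / real n) * delta_mod n (int j - int k)
      = cos (2 * pi * real a * real j / real n) * delta_mod n (int k - int j)"
    by (cases "j = k") auto
  moreover have "delta_mod n (int j - int k - 1) = delta_mod n (int k - int j + 1)"
    "delta_mod n (int j - int k + 1) = delta_mod n (int k - int j - 1)"
    using neg[of "int j - int k - 1"] neg[of "int j - int k + 1"] by (simp_all add: algebra_simps)
  ultimately show ?thesis using assms by (simp add: M_mat_def)
qed

lemma M_mat_row_sum:
  assumes "j < n"
  shows "(\<Sum>r<n. \<bar>M_mat n a $$ (j, r)\<bar>) \<le> 1"
proof -
  have n: "n > 0" using assms by simp
  have one: "(\<Sum>r<n. delta_mod n (i - int r)) = 1" for i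
    using sum_delta_mod[OF n, of "\<lambda>_. 1" i] by (simp flip: of_real_sum)
  have d0: "delta_mod n i \<ge> 0" for i by (simp add: delta_mod_def)
  have "\<bar>M_mat n a $$ (j, r)\<bar> \<le> delta_mod n ((int j - 1) - int r) / 4
     + delta_mod n ((int j + 1) - int r) / 4 + delta_mod n (int j - int r) / 2" if "r < n" for r
  proof -
    have "\<bar>cos (2 * pi * real a * real r / real n) * delta_mod n (int j - int r)\<bar> \<le> 1 * delta_mod n (int j - int r)"
      unfolding abs_mult using d0 by (intro mult_mono) auto
    then have *: "\<bar>1 / 2 * cos (2 * pi * real a * real r / real n) * delta_mod n (int j - int r)\<bar>
        \<le> delta_mod n (int j - int r) / 2"
      by (simp add: abs_mult)
    have "M_mat n a $$ (j, r) = (delta_mod n ((int j - 1) - int r) / 4 + delta_mod n ((int j + 1) - int r) / 4)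
        + 1 / 2 * cos (2 * pi * real a * real r / real n) * delta_mod n (int j - int r)"
      using assms that by (simp add: M_mat_def algebra_simps)
    then show ?thesis using * d0[of "(int j - 1) - int r"] d0[of "(int j + 1) - int r"] by linarith
  qed
  then have "(\<Sum>r<n. \<bar>M_mat n a $$ (j, r)\<bar>) \<le> (\<Sum>r<n. delta_mod n ((int j - 1) - int r) / 4
     + delta_mod n ((int j + 1) - int r) / 4 + delta_mod n (int j - int r) / 2)"
    by (intro sum_mono) auto
  also have "\<dots> = 1"
    by (simp add: sum.distrib one flip: sum_divide_distrib)
  finally show ?thesis .
qed

lemma abs_cos_diff_le: "\<bar>cos x - cos y\<bar> \<le> \<bar>x - y :: real\<bar>"
proof -
  have "\<bar>cos x - cos y\<bar> = 2 * \<bar>sin ((x + y) / 2)\<bar> * \<bar>sin ((y - x) / 2)\<bar>"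
    by (simp add: cos_diff_cos abs_mult)
  also have "\<dots> \<le> 2 * 1 * \<bar>(y - x) / 2\<bar>"
    by (intro mult_mono abs_sin_x_le_abs_x) auto
  finally show ?thesis by simp
qed

lemma abs_symb_le: "\<bar>symb a n m x\<bar> \<le> 1"
proof -
  have "\<bar>(c + d) / 2\<bar> \<le> 1" if "\<bar>c\<bar> \<le> 1" "\<bar>d\<bar> \<le> 1" for c d :: real
    using that by (auto simp: abs_le_iff)
  then show ?thesis unfolding symb_def by simp
qed

lemma symb_power_diff:
  assumes "\<bar>x - y\<bar> = 1"
  shows "\<bar>symb a n m x ^ k - symb a n m y ^ k\<bar> \<le> real k * (pi * real a / real n)"
proof -
  have "\<bar>symb a n m x ^ k - symb a n m y ^ k\<bar> \<le> real k * \<bar>symb a n m x - symb a n m y\<bar>"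
    using norm_power_diff[of "symb a n m x" "symb a n m y" k] abs_symb_le by simp
  also have "\<bar>symb a n m x - symb a n m y\<bar> \<le> pi * real a / real n"
  proof -
    have half: "u / 2 \<le> v" if "u \<le> 2 * v" for u v :: real using that by simp
    have "\<bar>cos (2 * pi * real a * of_int x / real n) - cos (2 * pi * real a * of_int y / real n)\<bar>
       \<le> \<bar>2 * pi * real a * of_int x / real n - 2 * pi * real a * of_int y / real n\<bar>"
      by (rule abs_cos_diff_le)
    also have "\<dots> = \<bar>2 * pi * real a / real n * of_int (x - y)\<bar>"
      by (simp add: algebra_simps diff_divide_distrib)
    also have "\<dots> = 2 * (pi * real a / real n)"
      using assms by (simp only: abs_mult of_int_abs[symmetric]) simp
    finally have "\<bar>cos (2 * pi * real a * of_int x / real n) - cos (2 * pi * real a * of_int y / real n)\<bar> / 2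
       \<le> pi * real a / real n" by (rule half)
    moreover have "symb a n m x - symb a n m y
       = (cos (2 * pi * real a * of_int x / real n) - cos (2 * pi * real a * of_int y / real n)) / 2"
      unfolding symb_def by argo
    ultimately show ?thesis by (simp only: abs_divide abs_numeral)
  qed
  finally show ?thesis by (simp add: mult_left_mono)
qed

text \<open>
  One application of the matrix to \<open>symbol^k \<cdot> wave\<close> would give exactly \<open>symbol^(k + 1) \<cdot> wave\<close> if the symbol had
  the same value at neighbouring sites; by \<open>symb_power_diff\<close> the discrepancy is at most
  \<open>k \<pi> a / n\<close>. The errors of earlier steps are not amplified, as absolute row sums are at most 1, so after
  \<open>k\<close> steps the total is at most \<open>(0 + 1 + ... + (k - 1)) \<pi> a / n\<close>, bounded here by \<open>k\<^sup>2 \<pi> a / n\<close>.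
\<close>
lemma M_mat_power_wave:
  assumes "j < n"
  shows "cmod ((\<Sum>r<n. of_real ((M_mat n a ^\<^sub>m k) $$ (j, r)) * wave n m (int r))
      - of_real (symb a n m (int j) ^ k) * wave n m (int j)) \<le> (real k)\<^sup>2 * (pi * real a / real n)"
  using assms
proof (induction k arbitrary: j)
  case 0
  then have "(\<Sum>r<n. of_real ((M_mat n a ^\<^sub>m 0) $$ (j, r)) * wave n m (int r))
      = (\<Sum>r<n. if r = j then wave n m (int r) else 0)"
    by (intro sum.cong refl) (simp add: M_mat_def)
  then show ?case using 0 by simp
next
  case (Suc k)
  define \<epsilon> where "\<epsilon> = pi * real a / real n"
  define A where "A = M_mat n a"
  define u where "u i = (\<Sum>r<n. of_real ((A ^\<^sub>m k) $$ (i, r)) * wave n m (int r))" for i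
  define f where "f x = of_real (symb a n m x ^ k) * wave n m x" for x
  have n: "n > 0" using Suc.prems by simp
  have \<epsilon>: "\<epsilon> \<ge> 0" by (simp add: \<epsilon>_def)
  have A: "A \<in> carrier_mat n n" by (simp add: A_def)
  have f: "f x = f y" if "int n dvd x - y" for x y
  proof -
    have "cos (2 * pi * real a * of_int x / real n) = cos (2 * pi * real a * of_int y / real n)"
      using wave_cong[OF n that, of a] by (simp flip: Re_wave)
    then show ?thesis using wave_cong[OF n that] by (simp add: f_def symb_def)
  qed
  \<comment> \<open>The new factor is needed on the left, where the row sum bound applies to it.\<close>
  have comm: "A ^\<^sub>m Suc k = A * A ^\<^sub>m k"
  proof (induction k)
    case (Suc k)
    then show ?case using A by (simp add: assoc_mult_mat[of A n n "A ^\<^sub>m k" n A n])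
  qed (use A in simp)
  have "(\<Sum>r<n. of_real ((A ^\<^sub>m Suc k) $$ (j, r)) * wave n m (int r))
     = (\<Sum>r<n. \<Sum>s<n. of_real (A $$ (j, s)) * (of_real ((A ^\<^sub>m k) $$ (s, r)) * wave n m (int r)))"
    unfolding comm using A Suc.prems
    by (intro sum.cong refl) (simp add: scalar_prod_def lessThan_atLeast0 sum_distrib_left sum_distrib_right mult_ac)
  also have "\<dots> = (\<Sum>s<n. of_real (A $$ (j, s)) * u s)"
    by (subst sum.swap) (simp add: u_def sum_distrib_left)
  finally have step: "(\<Sum>r<n. of_real ((A ^\<^sub>m Suc k) $$ (j, r)) * wave n m (int r))
      = (\<Sum>s<n. of_real (A $$ (j, s)) * u s)" .
  have "cmod ((\<Sum>s<n. of_real (A $$ (j, s)) * u s) - (\<Sum>s<n. of_real (A $$ (j, s)) * f (int s)))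
      \<le> (\<Sum>s<n. \<bar>A $$ (j, s)\<bar> * cmod (u s - f (int s)))"
    unfolding sum_subtractf[symmetric]
    by (rule order_trans[OF norm_sum]) (simp flip: right_diff_distrib add: norm_mult)
  also have "\<dots> \<le> (\<Sum>s<n. \<bar>A $$ (j, s)\<bar> * ((real k)\<^sup>2 * \<epsilon>))"
    using Suc.IH by (intro sum_mono mult_left_mono) (auto simp: u_def f_def A_def \<epsilon>_def)
  also have "\<dots> \<le> 1 * ((real k)\<^sup>2 * \<epsilon>)"
    unfolding sum_distrib_right[symmetric] A_def using M_mat_row_sum[OF Suc.prems] \<epsilon>
    by (intro mult_right_mono) auto
  finally have err1: "cmod ((\<Sum>s<n. of_real (A $$ (j, s)) * u s) - (\<Sum>s<n. of_real (A $$ (j, s)) * f (int s)))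
     \<le> (real k)\<^sup>2 * \<epsilon>" by simp
  define s where "s x = complex_of_real (symb a n m x ^ k)" for x
  define w where "w = wave n m"
  have "(\<Sum>s<n. of_real (A $$ (j, s)) * f (int s)) - of_real (symb a n m (int j) ^ Suc k) * w (int j)
     = ((s (int j - 1) - s (int j)) * w (int j - 1) + (s (int j + 1) - s (int j)) * w (int j + 1)) / 4"
  proof -
    have 1: "(\<Sum>s<n. of_real (A $$ (j, s)) * f (int s)) = (s (int j - 1) * w (int j - 1) + s (int j + 1) * w (int j + 1)) / 4
      + of_real (cos (2 * pi * real a * real j / real n)) / 2 * (s (int j) * w (int j))"
    proof -
      have "(\<Sum>s<n. of_real (A $$ (j, s)) * f (int s)) = (f (int j - 1) + f (int j + 1)) / 4
        + of_real (cos (2 * pi * real a * real j / real n)) / 2 * f (int j)"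
        unfolding A_def by (rule M_mat_apply[OF Suc.prems]) (rule f)
      then show ?thesis by (simp add: f_def s_def w_def)
    qed
    have "of_real (symb a n m (int j) ^ Suc k) * w (int j)
       = s (int j) * (2 * of_real (cos (2 * pi * real m / real n)) * w (int j)) / 4
         + of_real (cos (2 * pi * real a * real j / real n)) / 2 * (s (int j) * w (int j))"
      by (simp add: s_def symb_def field_simps)
    also have "2 * of_real (cos (2 * pi * real m / real n)) * w (int j) = w (int j - 1) + w (int j + 1)"
      using wave_neighbours[of n m "int j"] by (simp add: w_def)
    finally show ?thesis unfolding 1 by (simp add: field_simps)
  qed
  also have "cmod \<dots> \<le> (real k * \<epsilon> + real k * \<epsilon>) / 4"
  proof -
    have "cmod ((s x - s y) * w x) \<le> real k * \<epsilon>" if "\<bar>x - y\<bar> = 1" for x y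
      using symb_power_diff[OF that, of a n m k]
      by (simp add: norm_mult s_def w_def \<epsilon>_def flip: of_real_diff of_real_power)
    from norm_triangle_mono[OF this[of "int j - 1" "int j"] this[of "int j + 1" "int j"]]
    show ?thesis by (simp add: norm_divide)
  qed
  also have "\<dots> \<le> real k * \<epsilon>" using \<epsilon> by simp
  finally have "cmod ((\<Sum>s<n. of_real (A $$ (j, s)) * f (int s)) - of_real (symb a n m (int j) ^ Suc k) * w (int j))
     \<le> real k * \<epsilon>" .
  from norm_triangle_ineq4[THEN order_trans, OF add_mono[OF err1 this]] norm_triangle_mono[OF err1 this]
  have "cmod ((\<Sum>s<n. of_real (A $$ (j, s)) * u s) - of_real (symb a n m (int j) ^ Suc k) * w (int j))
     \<le> (real k)\<^sup>2 * \<epsilon> + real k * \<epsilon>" by simp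
  also have "\<dots> \<le> (real (Suc k))\<^sup>2 * \<epsilon>"
    using \<epsilon> by (simp add: power2_eq_square algebra_simps)
  finally show ?case unfolding step[symmetric] by (simp add: A_def w_def \<epsilon>_def)
qed

text \<open>
  The normalised waves form an orthonormal basis, so the trace is the mean over all frequencies \<open>m\<close> of
  \<open>\<Sum>j. cnj (wave m j) (M^k wave m) j\<close>; up to the error of \<open>M_mat_power_wave\<close> each summand is a
  power of the symbol.
\<close>
lemma trace_M_mat_power:
  assumes n: "n > 0"
  shows "\<bar>(\<Sum>i<n. (M_mat n a ^\<^sub>m k) $$ (i, i)) / n - (\<Sum>m<n. \<Sum>j<n. symb a n m (int j) ^ k) / (real n)\<^sup>2\<bar>
     \<le> (real k)\<^sup>2 * (pi * real a / real n)"
proof -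
  define P where "P j r = complex_of_real ((M_mat n a ^\<^sub>m k) $$ (j, r))" for j r
  define S where "S m j = complex_of_real (symb a n m (int j) ^ k)" for m j
  define u where "u m j = (\<Sum>r<n. P j r * wave n m (int r))" for m j
  have "(\<Sum>m<n. \<Sum>j<n. wave n m (- int j) * u m j)
     = (\<Sum>m<n. \<Sum>j<n. \<Sum>r<n. P j r * wave n m (int r - int j))"
    by (simp add: u_def sum_distrib_left mult_ac flip: wave_add)
  also have "\<dots> = (\<Sum>j<n. \<Sum>r<n. \<Sum>m<n. P j r * wave n m (int r - int j))"
    by (rule trans[OF sum.swap], rule sum.cong[OF refl], rule sum.swap)
  also have "\<dots> = (\<Sum>j<n. \<Sum>r<n. if r = j then P j r * of_nat n else 0)"
  proof (intro sum.cong refl)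
    fix j r assume "j \<in> {..<n}" "r \<in> {..<n}"
    then have "int n dvd int r - int j \<longleftrightarrow> r = j"
      by (auto simp flip: mod_eq_dvd_iff)
    then show "(\<Sum>m<n. P j r * wave n m (int r - int j)) = (if r = j then P j r * of_nat n else 0)"
      using wave_orthogonal[OF n, of "int r - int j"] by (simp flip: sum_distrib_left)
  qed
  also have "\<dots> = of_nat n * (\<Sum>j<n. P j j)"
    by (simp add: sum_distrib_left mult.commute)
  finally have tr: "(\<Sum>m<n. \<Sum>j<n. wave n m (- int j) * u m j) = of_nat n * (\<Sum>j<n. P j j)" .
  have "cmod (of_nat n * (\<Sum>j<n. P j j) - (\<Sum>m<n. \<Sum>j<n. S m j))
     = cmod (\<Sum>m<n. \<Sum>j<n. wave n m (- int j) * (u m j - S m j * wave n m (int j)))"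
  proof -
    have "wave n m (- int j) * (u m j - S m j * wave n m (int j)) = wave n m (- int j) * u m j - S m j" for m j
      using wave_add[of n m "- int j" "int j"] by (simp add: algebra_simps wave_def)
    then show ?thesis by (simp add: tr sum_subtractf)
  qed
  also have "\<dots> \<le> (\<Sum>m<n. \<Sum>j<n. (real k)\<^sup>2 * (pi * real a / real n))"
    using M_mat_power_wave[of _ n a k]
    by (intro sum_norm_le) (auto simp: norm_mult u_def P_def S_def)
  finally have "cmod (of_real (n * (\<Sum>i<n. (M_mat n a ^\<^sub>m k) $$ (i, i)) - (\<Sum>m<n. \<Sum>j<n. symb a n m (int j) ^ k)))
     \<le> (real n)\<^sup>2 * ((real k)\<^sup>2 * (pi * real a / real n))"
    by (simp add: P_def S_def power2_eq_square mult_ac)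
  then have "\<bar>n * (\<Sum>i<n. (M_mat n a ^\<^sub>m k) $$ (i, i)) - (\<Sum>m<n. \<Sum>j<n. symb a n m (int j) ^ k)\<bar> / (real n)\<^sup>2
     \<le> (real k)\<^sup>2 * (pi * real a / real n)"
    using n by (subst pos_divide_le_eq) (simp_all only: norm_of_real, simp_all add: mult_ac)
  also have "\<bar>n * (\<Sum>i<n. (M_mat n a ^\<^sub>m k) $$ (i, i)) - (\<Sum>m<n. \<Sum>j<n. symb a n m (int j) ^ k)\<bar> / (real n)\<^sup>2
      = \<bar>(n * (\<Sum>i<n. (M_mat n a ^\<^sub>m k) $$ (i, i)) - (\<Sum>m<n. \<Sum>j<n. symb a n m (int j) ^ k)) / (real n)\<^sup>2\<bar>"
    by simp
  also have "(n * (\<Sum>i<n. (M_mat n a ^\<^sub>m k) $$ (i, i)) - (\<Sum>m<n. \<Sum>j<n. symb a n m (int j) ^ k)) / (real n)\<^sup>2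
     = (\<Sum>i<n. (M_mat n a ^\<^sub>m k) $$ (i, i)) / n - (\<Sum>m<n. \<Sum>j<n. symb a n m (int j) ^ k) / (real n)\<^sup>2"
    using n by (simp add: diff_divide_distrib power2_eq_square)
  finally show ?thesis .
qed

section \<open>The limit law as a sum of two independent arcsine variables\<close>

text \<open>
  The arcsine density on \<open>(-1/2, 1/2)\<close>.
\<close>
definition half_sine_density :: "real \<Rightarrow> real" where
  "half_sine_density y = (if \<bar>y\<bar> < 1 / 2 then 2 / (pi * sqrt (1 - 4 * y\<^sup>2)) else 0)"

definition half_sine_law :: "real measure" where
  "half_sine_law = distr (uniform_measure lborel {- (pi / 2)..pi / 2}) borel (\<lambda>\<theta>. sin \<theta> / 2)"

lemma half_sine_density_measurable [measurable]: "half_sine_density \<in> borel_measurable borel"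
  unfolding half_sine_density_def by measurable

lemma half_sine_density_outside: "\<not> \<bar>y\<bar> < 1 / 2 \<Longrightarrow> half_sine_density y = 0"
  by (simp add: half_sine_density_def)

lemma half_sine_density_nonneg [simp]: "half_sine_density y \<ge> 0"
proof (cases "\<bar>y\<bar> < 1 / 2")
  case True
  then have "y\<^sup>2 \<le> (1 / 2)\<^sup>2" by (intro abs_le_square_iff[THEN iffD1]) auto
  then show ?thesis by (simp add: half_sine_density_def power2_eq_square)
qed (simp add: half_sine_density_def)

lemma half_sine_density_minus [simp]: "half_sine_density (- y) = half_sine_density y"
  by (simp add: half_sine_density_def)

lemma prob_space_uniform_angle: "prob_space (uniform_measure lborel {- (pi / 2)..pi / 2})"
  by (intro prob_space_uniform_measure) auto

lemma nn_integral_substitution_indicator: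
  fixes f g g' :: "real \<Rightarrow> real"
  assumes "f \<in> borel_measurable borel"
    and "\<And>x. x \<in> {a..b} \<Longrightarrow> (g has_real_derivative g' x) (at x)"
    and "continuous_on {a..b} g'" "\<And>x. x \<in> {a..b} \<Longrightarrow> g' x \<ge> 0" "a \<le> b"
  shows "(\<integral>\<^sup>+x. ennreal (f x) * indicator {g a..g b} x \<partial>lborel)
    = (\<integral>\<^sup>+x. ennreal (f (g x) * g' x) * indicator {a..b} x \<partial>lborel)"
proof -
  have "ennreal (r * indicator A x) = ennreal r * indicator A x" for r and A :: "real set" and x
    by (simp split: split_indicator)
  then show ?thesis
    using nn_integral_substitution[of g a b f g'] assms by (simp add: set_borel_measurable_def)
qed

lemma half_sine_law_density: "half_sine_law = density lborel half_sine_density"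
proof (rule measure_eqI)
  fix A assume "A \<in> sets half_sine_law"
  then have A [measurable]: "A \<in> sets borel" by (simp add: half_sine_law_def)
  let ?I = "{- (pi / 2)..pi / 2}"
  have "emeasure (density lborel half_sine_density) A = (\<integral>\<^sup>+y. ennreal (half_sine_density y) * indicator A y \<partial>lborel)"
    by (simp add: emeasure_density)
  also have "\<dots> = (\<integral>\<^sup>+y. ennreal (half_sine_density y * indicator A y) * indicator {sin (- (pi / 2)) / 2..sin (pi / 2) / 2} y \<partial>lborel)"
    by (intro nn_integral_cong) (auto simp: half_sine_density_def split: split_indicator)
  also have "\<dots> = (\<integral>\<^sup>+\<theta>. ennreal (half_sine_density (sin \<theta> / 2) * indicator A (sin \<theta> / 2) * (cos \<theta> / 2)) * indicator ?I \<theta> \<partial>lborel)"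
    by (rule nn_integral_substitution_indicator[where g = "\<lambda>\<theta>. sin \<theta> / 2" and a = "- (pi / 2)" and b = "pi / 2"])
      (auto intro!: derivative_eq_intros continuous_intros cos_ge_zero)
  also have "\<dots> = (\<integral>\<^sup>+\<theta>. ennreal (1 / pi) * (indicator A (sin \<theta> / 2) * indicator ?I \<theta>) \<partial>lborel)"
  proof (rule nn_integral_cong_AE)
    have "AE \<theta> in lborel. \<theta> \<noteq> pi / 2" "AE \<theta> in lborel. \<theta> \<noteq> - (pi / 2)"
      by (rule AE_lborel_singleton)+
    then show "AE \<theta> in lborel. ennreal (half_sine_density (sin \<theta> / 2) * indicator A (sin \<theta> / 2) * (cos \<theta> / 2)) * indicator ?I \<theta>
        = ennreal (1 / pi) * (indicator A (sin \<theta> / 2) * indicator ?I \<theta>)"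
    proof eventually_elim
      case (elim \<theta>)
      show ?case
      proof (cases "\<theta> \<in> ?I")
        case True
        with elim have c: "cos \<theta> > 0" by (intro cos_gt_zero_pi) auto
        then have "(sin \<theta>)\<^sup>2 < 1" using sin_cos_squared_add[of \<theta>] by (smt (verit) zero_less_power)
        then have "\<bar>sin \<theta>\<bar> < 1" by (simp add: abs_square_less_1)
        moreover have "sqrt (1 - 4 * (sin \<theta> / 2)\<^sup>2) = cos \<theta>"
          using c by (simp add: power_divide flip: cos_squared_eq)
        ultimately have "half_sine_density (sin \<theta> / 2) * (cos \<theta> / 2) = 1 / pi"
          using c by (simp add: half_sine_density_def)
        then show ?thesis by (auto split: split_indicator)
      qed simp
    qed
  qed
  also have "\<dots> = (\<integral>\<^sup>+\<theta>. indicator A (sin \<theta> / 2) * indicator ?I \<theta> \<partial>lborel) / emeasure lborel ?I"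
  proof -
    have "ennreal (1 / pi) * X = X / ennreal pi" for X
      using ennreal_times_divide[of X 1 "ennreal pi"] divide_ennreal[of 1 pi] by (simp add: mult.commute)
    moreover have "emeasure lborel ?I = ennreal pi" by simp
    ultimately show ?thesis by (subst nn_integral_cmult) simp_all
  qed
  also have "\<dots> = (\<integral>\<^sup>+\<theta>. indicator A (sin \<theta> / 2) \<partial>uniform_measure lborel ?I)"
    by (subst nn_integral_uniform_measure) auto
  also have "\<dots> = emeasure half_sine_law A"
  proof -
    have "emeasure half_sine_law A = (\<integral>\<^sup>+y. indicator A y \<partial>half_sine_law)"
      by (simp add: half_sine_law_def)
    also have "\<dots> = (\<integral>\<^sup>+\<theta>. indicator A (sin \<theta> / 2) \<partial>uniform_measure lborel ?I)"
      unfolding half_sine_law_def by (rule nn_integral_distr) simp_all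
    finally show ?thesis ..
  qed
  finally show "emeasure half_sine_law A = emeasure (density lborel half_sine_density) A" ..
qed (simp add: half_sine_law_def)

lemma real_distribution_half_sine_law: "real_distribution half_sine_law"
proof -
  interpret prob_space "uniform_measure lborel {- (pi / 2)..pi / 2}" by (rule prob_space_uniform_angle)
  show ?thesis unfolding half_sine_law_def by (intro real_distribution_distr) simp
qed

text \<open>
  The coefficients of \<open>1 / sqrt (1 - w)\<close>, equal to \<open>(2 j choose j) / 4^j\<close>; their squares are
  those of the hypergeometric series.
\<close>
definition central_coeff :: "nat \<Rightarrow> real" where
  "central_coeff j = pochhammer (1 / 2) j / fact j"

lemma central_coeff_Suc: "central_coeff (Suc j) = central_coeff j * (2 * j + 1) / (2 * j + 2)"
  by (simp add: central_coeff_def pochhammer_Suc field_simps)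

lemma central_coeff_0 [simp]: "central_coeff 0 = 1"
  by (simp add: central_coeff_def)

lemma central_coeff_bounds: "0 \<le> central_coeff j \<and> central_coeff j \<le> 1"
proof (induction j)
  case (Suc j)
  then have "central_coeff j * ((2 * j + 1) / (2 * j + 2)) \<le> 1 * 1"
    by (intro mult_mono) auto
  then show ?case using Suc by (simp add: central_coeff_Suc)
qed simp

lemma F21_half_half_one: "F21 (1 / 2) (1 / 2) 1 w = (\<Sum>j. (central_coeff j)\<^sup>2 * w ^ j)"
  unfolding F21_def by (simp add: central_coeff_def power2_eq_square pochhammer_fact[symmetric])

lemma central_coeff_sums:
  assumes "\<bar>w\<bar> < 1"
  shows "(\<lambda>j. central_coeff j * w ^ j) sums (1 / sqrt (1 - w))"
proof -
  have "(\<lambda>j. (- (1 / 2) gchoose j) * (- w) ^ j) sums (1 + (- w)) powr (- (1 / 2))"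
    using assms by (intro gen_binomial_real) auto
  also have "(\<lambda>j. (- (1 / 2) gchoose j) * (- w) ^ j) = (\<lambda>j. central_coeff j * w ^ j)"
  proof
    fix j
    show "(- (1 / 2) gchoose j) * (- w) ^ j = central_coeff j * w ^ j"
    proof -
      have "(- 1) ^ j * (- w) ^ j = w ^ j" by (simp flip: power_mult_distrib)
      then show ?thesis
        by (simp add: gbinomial_pochhammer central_coeff_def mult_ac)
    qed
  qed
  also have "(1 + (- w)) powr (- (1 / 2)) = 1 / sqrt (1 - w)"
    using assms by (simp add: powr_minus_divide powr_half_sqrt)
  finally show ?thesis .
qed

text \<open>
  Wallis' recursion, obtained by integrating the derivative of \<open>- cos \<theta> sin^(2 j + 1) \<theta>\<close>, which
  vanishes at both ends of the interval.
\<close>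
lemma sin_even_power_integral:
  "((\<lambda>\<theta>. sin \<theta> ^ (2 * j)) has_integral pi * central_coeff j) {- (pi / 2)..pi / 2}"
proof (induction j)
  case 0
  show ?case using has_integral_const_real[of "1::real" "- (pi / 2)" "pi / 2"] by simp
next
  case (Suc j)
  have "((\<lambda>\<theta>. (2 * j + 2) * sin \<theta> ^ (2 * Suc j) - (2 * j + 1) * sin \<theta> ^ (2 * j)) has_integral
      (- cos (pi / 2) * sin (pi / 2) ^ Suc (2 * j)) - (- cos (- (pi / 2)) * sin (- (pi / 2)) ^ Suc (2 * j)))
      {- (pi / 2)..pi / 2}"
  proof (rule fundamental_theorem_of_calculus)
    fix \<theta> :: real
    have "((\<lambda>\<theta>. - cos \<theta> * sin \<theta> ^ Suc (2 * j)) has_real_derivative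
        sin \<theta> * sin \<theta> ^ Suc (2 * j) - (2 * j + 1) * (cos \<theta>)\<^sup>2 * sin \<theta> ^ (2 * j)) (at \<theta> within {- (pi / 2)..pi / 2})"
      by (rule DERIV_cong[OF has_field_derivative_at_within[OF
            DERIV_mult[OF DERIV_minus[OF DERIV_cos] DERIV_power_Suc[OF DERIV_sin]]]])
        (simp add: power2_eq_square algebra_simps)
    also have "sin \<theta> * sin \<theta> ^ Suc (2 * j) - (2 * j + 1) * (cos \<theta>)\<^sup>2 * sin \<theta> ^ (2 * j)
        = (2 * j + 2) * sin \<theta> ^ (2 * Suc j) - (2 * j + 1) * sin \<theta> ^ (2 * j)"
      unfolding cos_squared_eq by (simp add: power2_eq_square algebra_simps)
    finally show "((\<lambda>\<theta>. - cos \<theta> * sin \<theta> ^ Suc (2 * j)) has_vector_derivative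
        (2 * j + 2) * sin \<theta> ^ (2 * Suc j) - (2 * j + 1) * sin \<theta> ^ (2 * j)) (at \<theta> within {- (pi / 2)..pi / 2})"
      by (simp add: has_real_derivative_iff_has_vector_derivative)
  qed auto
  then have "((\<lambda>\<theta>. (2 * j + 2) * sin \<theta> ^ (2 * Suc j) - (2 * j + 1) * sin \<theta> ^ (2 * j)) has_integral 0)
      {- (pi / 2)..pi / 2}" by simp
  from has_integral_divide[OF has_integral_add[OF this has_integral_mult_right[OF Suc, of "2 * j + 1"]], of "2 * j + 2"]
  have "((\<lambda>\<theta>. ((2 * j + 2) * sin \<theta> ^ (2 * Suc j) - (2 * j + 1) * sin \<theta> ^ (2 * j)
        + (2 * j + 1) * sin \<theta> ^ (2 * j)) / (2 * j + 2)) has_integral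
      (0 + (2 * j + 1) * (pi * central_coeff j)) / (2 * j + 2)) {- (pi / 2)..pi / 2}" .
  moreover have "(0 + (2 * j + 1) * (pi * central_coeff j)) / (2 * j + 2) = pi * central_coeff (Suc j)"
    by (simp add: central_coeff_Suc)
  moreover have "((2 * j + 2) * u - v + v) / (2 * j + 2) = u" for u v :: real
    by (simp add: divide_simps)
  ultimately show ?case by simp
qed

text \<open>
  Both factors are nonzero exactly for \<open>x - 1/2 < y < 1/2\<close>, an interval with midpoint \<open>x / 2\<close> and length
  \<open>1 - x\<close>; hence the substitution \<open>y = x / 2 + (1 - x) / 2 \<cdot> sin \<psi>\<close>. It makes the integrand equal to
  \<open>c / sqrt (1 - z\<^sup>2 sin\<^sup>2 \<psi>)\<close> with \<open>z = (1 - x) / (1 + x)\<close>. The binomial series of the inverse square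
  root has nonnegative terms and may be integrated term by term, each term giving the coefficient once more.
\<close>
lemma half_sine_convolution_pos:
  assumes x: "0 < x" "x < 1"
  shows "(\<integral>\<^sup>+y. ennreal (half_sine_density (x - y)) * ennreal (half_sine_density y) \<partial>lborel) = ennreal (f2 x)"
proof -
  let ?I = "{- (pi / 2)..pi / 2}"
  define z where "z = (1 - x) / (1 + x)"
  define c where "c = 2 / (pi\<^sup>2 * (1 + x))"
  define Y where "Y \<psi> = x / 2 + (1 - x) / 2 * sin \<psi>" for \<psi>
  have z: "0 < z" "z < 1" and c: "c \<ge> 0" using x by (auto simp: z_def c_def)
  have z2: "z\<^sup>2 < 1" using z by (simp add: power_less_one_iff)
  have "(\<integral>\<^sup>+y. ennreal (half_sine_density (x - y)) * ennreal (half_sine_density y) \<partial>lborel)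
    = (\<integral>\<^sup>+y. ennreal (half_sine_density (x - y) * half_sine_density y) * indicator {Y (- (pi / 2))..Y (pi / 2)} y \<partial>lborel)"
  proof (intro nn_integral_cong)
    fix y :: real
    have "half_sine_density (x - y) * half_sine_density y = 0" if "y \<notin> {Y (- (pi / 2))..Y (pi / 2)}"
    proof -
      have "\<not> (\<bar>x - y\<bar> < 1 / 2 \<and> \<bar>y\<bar> < 1 / 2)"
        using that by (auto simp: Y_def field_simps)
      then show ?thesis using half_sine_density_outside by auto
    qed
    then show "ennreal (half_sine_density (x - y)) * ennreal (half_sine_density y)
      = ennreal (half_sine_density (x - y) * half_sine_density y) * indicator {Y (- (pi / 2))..Y (pi / 2)} y"
      by (simp split: split_indicator flip: ennreal_mult)
  qed
  also have "\<dots> = (\<integral>\<^sup>+\<psi>. ennreal (half_sine_density (x - Y \<psi>) * half_sine_density (Y \<psi>) * ((1 - x) / 2 * cos \<psi>)) * indicator ?I \<psi> \<partial>lborel)"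
  proof (rule nn_integral_substitution_indicator)
    show "(Y has_real_derivative (1 - x) / 2 * cos \<psi>) (at \<psi>)" for \<psi>
      unfolding Y_def by (auto intro!: derivative_eq_intros)
  qed (use x in \<open>auto intro!: continuous_intros cos_ge_zero mult_nonneg_nonneg\<close>)
  also have "\<dots> = (\<integral>\<^sup>+\<psi>. (\<Sum>j. ennreal (c * central_coeff j * (z\<^sup>2) ^ j) * (indicator ?I \<psi> * ennreal (sin \<psi> ^ (2 * j)))) \<partial>lborel)"
  proof (rule nn_integral_cong_AE)
    have "AE \<theta> in lborel. \<theta> \<noteq> pi / 2" "AE \<theta> in lborel. \<theta> \<noteq> - (pi / 2)"
      by (rule AE_lborel_singleton)+
    then show "AE \<psi> in lborel. ennreal (half_sine_density (x - Y \<psi>) * half_sine_density (Y \<psi>) * ((1 - x) / 2 * cos \<psi>)) * indicator ?I \<psi>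
       = (\<Sum>j. ennreal (c * central_coeff j * (z\<^sup>2) ^ j) * (indicator ?I \<psi> * ennreal (sin \<psi> ^ (2 * j))))"
    proof eventually_elim
      case (elim \<psi>)
      show ?case
      proof (cases "\<psi> \<in> ?I")
        case True
        with elim have cp: "cos \<psi> > 0" by (intro cos_gt_zero_pi) auto
        define s where "s = sin \<psi>"
        have s2: "s\<^sup>2 = 1 - (cos \<psi>)\<^sup>2" by (simp add: s_def sin_squared_eq)
        then have "s\<^sup>2 < 1" using cp by simp
        then have s: "\<bar>s\<bar> < 1" by (simp add: abs_square_less_1)
        define t where "t = (1 - x) * s"
        have t: "\<bar>t\<bar> < 1 - x" using s x by (simp add: t_def abs_mult)
        have y: "Y \<psi> = (x + t) / 2" "x - Y \<psi> = (x - t) / 2"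
          by (simp_all add: Y_def t_def s_def field_simps)
        have q: "(z * s)\<^sup>2 < 1"
        proof -
          have "\<bar>z * s\<bar> < 1 * 1" unfolding abs_mult using z s by (intro mult_strict_mono) auto
          then show ?thesis by (simp add: abs_square_less_1)
        qed
        \<comment> \<open>Pairing the four linear factors crosswise separates \<open>1 - x\<close> from \<open>1 + x\<close>.\<close>
        have "sqrt (1 - 4 * ((x - t) / 2)\<^sup>2) * sqrt (1 - 4 * ((x + t) / 2)\<^sup>2)
          = sqrt (((1 - x)\<^sup>2 - t\<^sup>2) * ((1 + x)\<^sup>2 - t\<^sup>2))"
          unfolding real_sqrt_mult[symmetric] 
        proof (rule arg_cong[where f = sqrt])
          have "4 * ((x - t) / 2)\<^sup>2 = (x - t)\<^sup>2" "4 * ((x + t) / 2)\<^sup>2 = (x + t)\<^sup>2"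
            by (simp_all add: power_divide)
          moreover have "(1 - (x - t)\<^sup>2) * (1 - (x + t)\<^sup>2) = ((1 - x)\<^sup>2 - t\<^sup>2) * ((1 + x)\<^sup>2 - t\<^sup>2)"
            by (simp add: power2_eq_square algebra_simps)
          ultimately show "(1 - 4 * ((x - t) / 2)\<^sup>2) * (1 - 4 * ((x + t) / 2)\<^sup>2) = ((1 - x)\<^sup>2 - t\<^sup>2) * ((1 + x)\<^sup>2 - t\<^sup>2)"
            by (simp only:)
        qed
        also have "((1 - x)\<^sup>2 - t\<^sup>2) * ((1 + x)\<^sup>2 - t\<^sup>2) = ((1 - x) * cos \<psi> * (1 + x))\<^sup>2 * (1 - (z * s)\<^sup>2)"
        proof -
          have "(1 - x)\<^sup>2 - t\<^sup>2 = ((1 - x) * cos \<psi>)\<^sup>2"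
            using s2 by (simp add: t_def power_mult_distrib right_diff_distrib)
          moreover have "(1 + x)\<^sup>2 - t\<^sup>2 = (1 + x)\<^sup>2 * (1 - (z * s)\<^sup>2)"
            using x by (simp add: t_def z_def power_mult_distrib power_divide right_diff_distrib)
          ultimately show ?thesis by (simp add: power_mult_distrib mult_ac)
        qed
        also have "sqrt \<dots> = (1 - x) * cos \<psi> * (1 + x) * sqrt (1 - (z * s)\<^sup>2)"
          using x cp by (simp add: real_sqrt_mult)
        finally have sq: "sqrt (1 - 4 * ((x - t) / 2)\<^sup>2) * sqrt (1 - 4 * ((x + t) / 2)\<^sup>2)
          = (1 - x) * cos \<psi> * (1 + x) * sqrt (1 - (z * s)\<^sup>2)" .
        have rng: "\<bar>(x - t) / 2\<bar> < 1 / 2" "\<bar>(x + t) / 2\<bar> < 1 / 2" using t x by (auto simp: abs_if split: if_splits)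
        have "half_sine_density (x - Y \<psi>) * half_sine_density (Y \<psi>) * ((1 - x) / 2 * cos \<psi>)
          = 4 / (pi\<^sup>2 * (sqrt (1 - 4 * ((x - t) / 2)\<^sup>2) * sqrt (1 - 4 * ((x + t) / 2)\<^sup>2))) * ((1 - x) / 2 * cos \<psi>)"
          unfolding y(2) unfolding y(1) half_sine_density_def using rng by (simp add: power2_eq_square[of pi] mult_ac)
        also have "\<dots> = c * (1 / sqrt (1 - (z * s)\<^sup>2))"
        proof -
          have "1 - x \<noteq> 0" "1 + x \<noteq> 0" "cos \<psi> \<noteq> 0" "sqrt (1 - (z * s)\<^sup>2) \<noteq> 0" using x cp q by auto
          then show ?thesis unfolding sq c_def by (simp add: divide_simps)
        qed
        finally have int: "half_sine_density (x - Y \<psi>) * half_sine_density (Y \<psi>) * ((1 - x) / 2 * cos \<psi>)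
          = c * (1 / sqrt (1 - (z * s)\<^sup>2))" .
        have "(\<lambda>j. c * (central_coeff j * ((z * s)\<^sup>2) ^ j)) sums (c * (1 / sqrt (1 - (z * s)\<^sup>2)))"
          using q by (intro sums_mult central_coeff_sums) auto
        then have "(\<lambda>j. (c * central_coeff j * (z\<^sup>2) ^ j) * s ^ (2 * j)) sums (c * (1 / sqrt (1 - (z * s)\<^sup>2)))"
        proof -
          have "((z * s)\<^sup>2) ^ j = (z\<^sup>2) ^ j * s ^ (2 * j)" for j
            by (metis power_mult power_mult_distrib)
          then show ?thesis
            using \<open>(\<lambda>j. c * (central_coeff j * ((z * s)\<^sup>2) ^ j)) sums _\<close> by (simp only: mult.assoc)
        qed
        then have "(\<Sum>j. ennreal ((c * central_coeff j * (z\<^sup>2) ^ j) * s ^ (2 * j))) = ennreal (c * (1 / sqrt (1 - (z * s)\<^sup>2)))"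
          using c central_coeff_bounds by (intro suminf_ennreal_eq) auto
        moreover have "ennreal ((c * central_coeff j * (z\<^sup>2) ^ j) * s ^ (2 * j))
           = ennreal (c * central_coeff j * (z\<^sup>2) ^ j) * ennreal (s ^ (2 * j))" for j
          using c central_coeff_bounds by (intro ennreal_mult) auto
        ultimately show ?thesis using True unfolding int by (simp add: s_def)
      qed simp
    qed
  qed
  also have "\<dots> = (\<Sum>j. \<integral>\<^sup>+\<psi>. ennreal (c * central_coeff j * (z\<^sup>2) ^ j) * (indicator ?I \<psi> * ennreal (sin \<psi> ^ (2 * j))) \<partial>lborel)"
    by (rule nn_integral_suminf) measurable
  also have "\<dots> = (\<Sum>j. ennreal (c * central_coeff j * (z\<^sup>2) ^ j * (pi * central_coeff j)))"
  proof (intro suminf_cong)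
    fix j
    have "(\<integral>\<^sup>+\<psi>. indicator ?I \<psi> * ennreal (sin \<psi> ^ (2 * j)) \<partial>lborel) = ennreal (pi * central_coeff j)"
    proof -
      have "indicator ?I \<psi> * ennreal (sin \<psi> ^ (2 * j)) = ennreal (indicator ?I \<psi> * sin \<psi> ^ (2 * j))" for \<psi>
        by (simp split: split_indicator)
      moreover have "(\<integral>\<^sup>+\<psi>. ennreal (indicator ?I \<psi> * sin \<psi> ^ (2 * j)) \<partial>lborel) = ennreal (pi * central_coeff j)"
        by (rule nn_integral_has_integral_lebesgue[OF _ sin_even_power_integral[of j]]) simp
      ultimately show ?thesis by (simp only:)
    qed
    then show "(\<integral>\<^sup>+\<psi>. ennreal (c * central_coeff j * (z\<^sup>2) ^ j) * (indicator ?I \<psi> * ennreal (sin \<psi> ^ (2 * j))) \<partial>lborel)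
       = ennreal (c * central_coeff j * (z\<^sup>2) ^ j * (pi * central_coeff j))"
      using c central_coeff_bounds[of j] by (subst nn_integral_cmult) (auto simp: ennreal_mult)
  qed
  also have "\<dots> = (\<Sum>j. ennreal (2 / (pi * (1 + x)) * ((central_coeff j)\<^sup>2 * (z\<^sup>2) ^ j)))"
    using x by (intro suminf_cong arg_cong[where f = ennreal]) (simp add: c_def power2_eq_square)
  also have "\<dots> = ennreal (2 / (pi * (1 + x)) * F21 (1 / 2) (1 / 2) 1 (z\<^sup>2))"
  proof (rule suminf_ennreal_eq)
    have "summable (\<lambda>j. (central_coeff j)\<^sup>2 * (z\<^sup>2) ^ j)"
    proof (rule summable_comparison_test')
      show "summable (\<lambda>j. (z\<^sup>2) ^ j)" using z2 by (intro summable_geometric) auto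
      show "norm ((central_coeff j)\<^sup>2 * (z\<^sup>2) ^ j) \<le> (z\<^sup>2) ^ j" for j
        using central_coeff_bounds[of j] by (simp add: abs_mult mult_left_le_one_le power_le_one)
    qed
    then show "(\<lambda>j. 2 / (pi * (1 + x)) * ((central_coeff j)\<^sup>2 * (z\<^sup>2) ^ j)) sums (2 / (pi * (1 + x)) * F21 (1 / 2) (1 / 2) 1 (z\<^sup>2))"
      unfolding F21_half_half_one by (intro sums_mult summable_sums)
  qed (use x in auto)
  also have "2 / (pi * (1 + x)) * F21 (1 / 2) (1 / 2) 1 (z\<^sup>2) = f2 x"
    using x by (simp add: f2_def z_def)
  finally show ?thesis .
qed

lemma f2_measurable [measurable]: "f2 \<in> borel_measurable borel"
proof -
  have [measurable]: "(\<lambda>w. F21 (1 / 2) (1 / 2) 1 w) \<in> borel_measurable borel"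
    unfolding F21_def by measurable
  show ?thesis unfolding f2_def by measurable
qed

text \<open>
  The values \<open>x = 0\<close>, where the series diverges, and \<open>x = 1\<close>, \<open>x = -1\<close> are excluded as null sets;
  negative \<open>x\<close> are reduced to positive ones by symmetry of the arcsine density.
\<close>
lemma mu2_convolution: "mu2 = convolution half_sine_law half_sine_law"
proof -
  interpret real_distribution half_sine_law by (rule real_distribution_half_sine_law)
  have fin: "finite_measure (density lborel half_sine_density)"
    unfolding half_sine_law_density[symmetric] by unfold_locales
  let ?c = "\<lambda>x. \<integral>\<^sup>+y. ennreal (half_sine_density (x - y)) * ennreal (half_sine_density y) \<partial>lborel"
  have even: "?c (- x) = ?c x" for x
  proof -
    have "?c (- x) = (\<integral>\<^sup>+y. ennreal (half_sine_density (- x - (- y))) * ennreal (half_sine_density (- y)) \<partial>lborel)"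
      by (subst nn_integral_real_affine[where c = "-1" and t = 0]) auto
    also have "\<dots> = ?c x"
      using half_sine_density_minus[of "x - _"] by (intro nn_integral_cong) (simp add: algebra_simps)
    finally show ?thesis .
  qed
  have "mu2 = density lborel ?c"
    unfolding mu2_def
  proof (rule density_cong)
    show "(\<lambda>x. ennreal (f2 x)) \<in> borel_measurable lborel" by simp
    show "?c \<in> borel_measurable lborel" by measurable
    have "AE x in lborel. x \<noteq> 0" "AE x in lborel. x \<noteq> 1" "AE x in lborel. x \<noteq> (-1 :: real)"
      by (rule AE_lborel_singleton)+
    then show "AE x in lborel. ennreal (f2 x) = ?c x"
    proof eventually_elim
      case (elim x)
      show ?case
      proof (cases "\<bar>x\<bar> < 1")
        case True
        have "?c x = ?c \<bar>x\<bar>" using even[of x] by (simp add: abs_if)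
        also have "\<dots> = ennreal (f2 \<bar>x\<bar>)" using elim True by (intro half_sine_convolution_pos) auto
        also have "f2 \<bar>x\<bar> = f2 x"
        proof -
          have "-1 \<le> \<bar>x\<bar>" "\<bar>x\<bar> \<le> 1" "-1 \<le> x" "x \<le> 1" using True by auto
          then show ?thesis by (simp add: f2_def)
        qed
        finally show ?thesis ..
      next
        case False
        have "half_sine_density (x - y) = 0 \<or> half_sine_density y = 0" for y
        proof -
          have "\<not> (\<bar>x - y\<bar> < 1 / 2 \<and> \<bar>y\<bar> < 1 / 2)" using False by linarith
          then show ?thesis using half_sine_density_outside by blast
        qed
        then have "ennreal (half_sine_density (x - y)) * ennreal (half_sine_density y) = 0" for y
          by (metis ennreal_0 mult_zero_left mult_zero_right)
        then have "?c x = (\<integral>\<^sup>+y. 0 \<partial>(lborel :: real measure))" by (simp only:)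
        then show ?thesis using False elim by (auto simp: f2_def)
      qed
    qed
  qed
  also have "\<dots> = convolution half_sine_law half_sine_law"
    unfolding half_sine_law_density by (subst convolution_density) (auto intro: fin)
  finally show ?thesis .
qed

lemma real_distribution_mu2: "real_distribution mu2"
proof -
  interpret N: real_distribution half_sine_law by (rule real_distribution_half_sine_law)
  interpret P: pair_prob_space half_sine_law half_sine_law by unfold_locales
  show ?thesis
    unfolding mu2_convolution convolution_def
    by (intro P.real_distribution_distr) measurable
qed

lemma char_mu2: "char mu2 t = (char half_sine_law t)\<^sup>2"
proof -
  interpret N: real_distribution half_sine_law by (rule real_distribution_half_sine_law)
  interpret P: pair_prob_space half_sine_law half_sine_law by unfold_locales
  have "char mu2 t = (CLINT p|half_sine_law \<Otimes>\<^sub>M half_sine_law. iexp (t * (fst p + snd p)))"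
    unfolding mu2_convolution convolution_def char_def
    by (subst integral_distr) (auto simp: case_prod_beta)
  also have "\<dots> = (CLINT x|half_sine_law. CLINT y|half_sine_law. iexp (t * x) * iexp (t * y))"
    by (subst P.integral_fst'[symmetric])
      (auto intro!: P.integrable_const_bound[where B = 1] simp: ring_distribs exp_add norm_mult)
  also have "\<dots> = (char half_sine_law t)\<^sup>2"
    by (simp add: char_def power2_eq_square)
  finally show ?thesis .
qed

section \<open>Convergence of characteristic functions\<close>

lemma iexp_lipschitz: "cmod (iexp x - iexp y) \<le> \<bar>x - y\<bar>"
proof -
  have "iexp x - iexp y = iexp y * (iexp (x - y) - 1)"
    by (simp add: ring_distribs flip: exp_add)
  then have "cmod (iexp x - iexp y) = cmod (iexp (x - y) - 1)"
    by (simp add: norm_mult)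
  also have "\<dots> \<le> \<bar>x - y\<bar>"
    using iexp_approx1[of "x - y" 0] by simp
  finally show ?thesis .
qed

lemma riemann_sum_tendsto:
  fixes g :: "real \<Rightarrow> complex"
  assumes lip: "\<And>x y. cmod (g x - g y) \<le> L * \<bar>x - y\<bar>" and int: "(g has_integral I) {0..1}"
  shows "(\<lambda>n. (\<Sum>m<n. g (real m / real n)) / of_nat n) \<longlonglongrightarrow> I"
proof -
  have "continuous_on UNIV g"
  proof (rule lipschitz_on_continuous_on)
    have "L \<ge> 0" using norm_ge_zero[THEN order_trans, OF lip[of 0 1]] by simp
    then show "L-lipschitz_on UNIV g" using lip by (intro lipschitz_onI) (auto simp: dist_norm)
  qed
  then have cont: "continuous_on S g" for S by (rule continuous_on_subset) simp
  have "cmod ((\<Sum>m<n. g (real m / real n)) / of_nat n - I) \<le> L * (1 / real n)" if n: "n > 0" for n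
  proof -
    define J where "J m = integral {real m / real n..real (Suc m) / real n} g" for m
    have J: "(g has_integral J m) {real m / real n..real (Suc m) / real n}" for m
      unfolding J_def by (intro integrable_integral integrable_continuous_real cont)
    have "(g has_integral (\<Sum>m<k. J m)) {0..real k / real n}" for k
    proof (induction k)
      case (Suc k)
      from has_integral_combine[OF _ _ Suc J[of k]] show ?case
        by (simp add: divide_right_mono)
    qed (use has_integral_null_real[of 0 0 g] in simp)
    from this[of n] have I: "I = (\<Sum>m<n. J m)"
      using n int by (auto intro: has_integral_unique)
    have "cmod (J m - g (real m / real n) / of_nat n) \<le> (L * (1 / real n)) * (1 / real n)" for m
    proof -
      have len: "real (Suc m) / real n - real m / real n = 1 / real n"
        by (simp add: diff_divide_distrib[symmetric])
      have "((\<lambda>x. g x - g (real m / real n)) has_integral (J m - (1 / real n) *\<^sub>R g (real m / real n)))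
          {real m / real n..real (Suc m) / real n}"
        using has_integral_diff[OF J[of m] has_integral_const_real[of "g (real m / real n)" "real m / real n" "real (Suc m) / real n"]]
        by (simp add: len[simplified] divide_right_mono)
      then have "cmod (J m - (1 / real n) *\<^sub>R g (real m / real n)) \<le> (L * (1 / real n)) * measure lborel {real m / real n..real (Suc m) / real n}"
      proof (rule has_integral_bound_real[where S = "{}", rotated 2])
        have L: "L \<ge> 0" using norm_ge_zero[THEN order_trans, OF lip[of 0 1]] by simp
        then show "0 \<le> L * (1 / real n)" by simp
        fix x assume "x \<in> {real m / real n..real (Suc m) / real n} - {}"
        then have "\<bar>x - real m / real n\<bar> \<le> 1 / real n" using len by auto
        then have "L * \<bar>x - real m / real n\<bar> \<le> L * (1 / real n)" using L by (rule mult_left_mono)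
        then show "cmod (g x - g (real m / real n)) \<le> L * (1 / real n)"
          using lip[of x "real m / real n"] by linarith
      qed simp_all
      also have "(1 / real n) *\<^sub>R g (real m / real n) = g (real m / real n) / of_nat n"
        by (simp add: scaleR_conv_of_real)
      also have "measure lborel {real m / real n..real (Suc m) / real n} = 1 / real n"
        using len by (simp add: divide_right_mono)
      finally show ?thesis .
    qed
    then have "cmod (\<Sum>m<n. J m - g (real m / real n) / of_nat n) \<le> (\<Sum>m<n. (L * (1 / real n)) * (1 / real n))"
      by (intro sum_norm_le) auto
    then show ?thesis
      using n unfolding I by (simp add: sum_subtractf norm_minus_commute flip: sum_divide_distrib)
  qed
  then have ev: "eventually (\<lambda>n. cmod ((\<Sum>m<n. g (real m / real n)) / of_nat n - I) \<le> L * (1 / real n)) sequentially"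
    by (intro eventually_mono[OF eventually_gt_at_top[of 0]]) auto
  have "(\<lambda>n. L * (1 / real n)) \<longlonglongrightarrow> 0"
    using tendsto_mult[OF tendsto_const lim_1_over_n] by simp
  from Lim_null_comparison[OF ev this] show ?thesis by (simp add: LIM_zero_iff)
qed

text \<open>
  With \<open>\<theta> = \<pi> / 2 + 2 \<pi> a u\<close> the left-hand function is \<open>h (sin \<theta>)\<close>, and \<open>\<theta>\<close> runs through \<open>a\<close> full
  periods. Each period consists of two half periods, and the reflection \<open>\<theta> \<mapsto> \<pi> - \<theta>\<close> shows that both contribute
  the same amount \<open>J\<close>. The change of variables divides the total \<open>2 a J\<close> by \<open>2 \<pi> a\<close>.
\<close>
lemma has_integral_cosine_wave:
  fixes h :: "real \<Rightarrow> complex"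
  assumes h: "continuous_on UNIV h" and a: "a > 0"
    and J: "((\<lambda>\<theta>. h (sin \<theta>)) has_integral J) {- (pi / 2)..pi / 2}"
  shows "((\<lambda>u. h (cos (2 * pi * real a * u))) has_integral J / pi) {0..1}"
proof -
  define p where "p \<theta> = h (sin \<theta>)" for \<theta>
  have p_refl: "p (pi - \<theta>) = p \<theta>" for \<theta> by (simp add: p_def)
  have p_per: "p (\<theta> - 2 * pi * real k) = p \<theta>" for \<theta> k
  proof -
    have "sin (2 * pi * real k) = 0" "cos (2 * pi * real k) = 1"
      using sin_2npi[of k] cos_2npi[of k] by (simp_all add: mult_ac)
    then show ?thesis by (simp add: p_def sin_diff)
  qed
  have J0: "(p has_integral J) {- (pi / 2)..pi / 2}" using J by (simp add: p_def[abs_def])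
  have aff: "((\<lambda>x. p (m * x + c)) has_integral (1 / \<bar>m\<bar>) *\<^sub>R I) ((\<lambda>x. (1 / m) * x + - (c / m)) ` {l..r})"
    if "(p has_integral I) {l..r}" "m \<noteq> 0" for I l r m c
    using has_integral_affinity[of p I l r m c] that by simp
  have J1: "(p has_integral J) {pi / 2..3 * pi / 2}"
    using aff[OF J0, of "-1" pi] p_refl by (simp add: image_affinity_atLeastAtMost_diff image_affinity_atLeastAtMost algebra_simps)
  have J2: "(p has_integral J) {pi / 2 + 2 * pi * real k..3 * pi / 2 + 2 * pi * real k}" for k
    using aff[OF J1, of "1" "- (2 * pi * real k)"] p_per by simp
  have J3: "(p has_integral J) {3 * pi / 2 + 2 * pi * real k..pi / 2 + 2 * pi * real (Suc k)}" for k
    using aff[OF J0, of "1" "- (2 * pi * real (Suc k))"] p_per[of _ "Suc k"] by (simp add: algebra_simps)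
  have all: "(p has_integral of_nat (2 * k) * J) {pi / 2..pi / 2 + 2 * pi * real k}" for k
  proof (induction k)
    case (Suc k)
    have "(p has_integral J + J) {pi / 2 + 2 * pi * real k..pi / 2 + 2 * pi * real (Suc k)}"
      by (rule has_integral_combine[OF _ _ J2 J3]) (simp_all add: algebra_simps)
    from has_integral_combine[OF _ _ Suc this] show ?case by (simp add: algebra_simps)
  qed (use has_integral_null_real[of "pi / 2" "pi / 2" p] in simp)
  define M where "M = 2 * pi * real a"
  have M: "M > 0" using a by (simp add: M_def)
  have "(\<lambda>x. (1 / M) * x + - (pi / 2 / M)) ` {pi / 2..pi / 2 + M} = {0..1}"
    using M by (subst image_affinity_atLeastAtMost) (auto simp: add_divide_distrib)
  then have "((\<lambda>x. p (2 * pi * real a * x + pi / 2)) has_integral (1 / (2 * pi * real a)) *\<^sub>R (of_nat (2 * a) * J)) {0..1}"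
    using aff[OF all, of M "pi / 2" a] M by (simp only: M_def[symmetric] abs_of_pos less_imp_neq[symmetric] not_False_eq_True)
  also have "(1 / (2 * pi * real a)) *\<^sub>R (of_nat (2 * a) * J) = J / pi"
    using a by (simp add: scaleR_conv_of_real field_simps)
  finally show ?thesis by (simp add: p_def sin_cos_eq[symmetric] sin_add)
qed

lemma real_distribution_Lambda_emp:
  assumes "n > 0"
  shows "real_distribution (Lambda_emp n a)"
proof -
  interpret prob_space "uniform_count_measure {..<n}"
    using assms by (intro prob_space_uniform_count_measure) auto
  show ?thesis unfolding Lambda_emp_def
    by (rule real_distribution_distr) (simp add: measurable_def sets_uniform_count_measure space_uniform_count_measure)
qed

lemma char_Lambda_emp:
  assumes "n > 0"
  shows "char (Lambda_emp n a) t = (\<Sum>i<n. iexp (t * ordered_eigenvalues (M_mat n a) ! i)) / of_nat n"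
proof -
  have meas: "f \<in> measurable (uniform_count_measure {..<n}) borel" for f :: "nat \<Rightarrow> real"
    by (simp add: measurable_def sets_uniform_count_measure space_uniform_count_measure)
  have "char (Lambda_emp n a) t = (CLINT i|uniform_count_measure {..<n}. iexp (t * ordered_eigenvalues (M_mat n a) ! i))"
    unfolding char_def Lambda_emp_def by (rule integral_distr) (auto intro: meas)
  also have "\<dots> = (\<Sum>i<n. iexp (t * ordered_eigenvalues (M_mat n a) ! i)) / of_nat n"
    unfolding uniform_count_measure_def
    by (subst lebesgue_integral_point_measure_finite) (auto simp: scaleR_conv_of_real sum_divide_distrib)
  finally show ?thesis .
qed

lemma iexp_sums: "(\<lambda>k. (\<i> * of_real t) ^ k /\<^sub>R fact k * of_real (x ^ k)) sums iexp (t * x)"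
  using exp_converges[of "\<i> * of_real (t * x)"]
  by (simp add: power_mult_distrib mult_ac)

text \<open>
  Both exponential sums are expanded into power series in \<open>t\<close>; their coefficients differ by the errors
  of \<open>trace_M_mat_power\<close>, and \<open>k\<^sup>2 \<le> 4^k\<close> bounds the sum of these errors by an exponential series.
\<close>
lemma char_Lambda_emp_approx:
  assumes n: "n > 0"
  shows "cmod (char (Lambda_emp n a) t - (\<Sum>m<n. \<Sum>j<n. iexp (t * symb a n m (int j))) / (of_nat n)\<^sup>2)
     \<le> (pi * real a * exp (4 * \<bar>t\<bar>)) / real n"
proof -
  define ev where "ev = ordered_eigenvalues (M_mat n a)"
  define c where "c k = (\<i> * complex_of_real t) ^ k /\<^sub>R fact k" for k
  define d where "d k = (\<Sum>i<n. ev ! i ^ k) / n - (\<Sum>m<n. \<Sum>j<n. symb a n m (int j) ^ k) / (real n)\<^sup>2" for k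
  have d: "\<bar>d k\<bar> \<le> (real k)\<^sup>2 * (pi * real a / real n)" for k
  proof -
    have "(\<Sum>i<n. ev ! i ^ k) = (\<Sum>e\<leftarrow>ev. e ^ k)"
      using ordered_eigenvalues_symmetric(1)[OF M_mat_carrier M_mat_symmetric, of n a]
      by (simp add: sum_list_sum_nth ev_def lessThan_atLeast0)
    also have "\<dots> = (\<Sum>i<n. (M_mat n a ^\<^sub>m k) $$ (i, i))"
      unfolding ev_def by (rule ordered_eigenvalues_symmetric(2)[OF M_mat_carrier M_mat_symmetric])
    finally show ?thesis unfolding d_def using trace_M_mat_power[OF n, of a k] by simp
  qed
  have "(\<lambda>k. (\<Sum>i<n. c k * of_real (ev ! i ^ k)) / of_nat n
      - (\<Sum>m<n. \<Sum>j<n. c k * of_real (symb a n m (int j) ^ k)) / (of_nat n)\<^sup>2)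
     sums ((\<Sum>i<n. iexp (t * ev ! i)) / of_nat n - (\<Sum>m<n. \<Sum>j<n. iexp (t * symb a n m (int j))) / (of_nat n)\<^sup>2)"
    unfolding c_def by (intro sums_diff sums_divide sums_sum iexp_sums)
  moreover have "(\<Sum>i<n. c k * of_real (ev ! i ^ k)) / of_nat n
      - (\<Sum>m<n. \<Sum>j<n. c k * of_real (symb a n m (int j) ^ k)) / (of_nat n)\<^sup>2 = c k * of_real (d k)" for k
    by (simp add: d_def right_diff_distrib sum_distrib_left)
  ultimately have sums: "(\<lambda>k. c k * of_real (d k)) sums
    (char (Lambda_emp n a) t - (\<Sum>m<n. \<Sum>j<n. iexp (t * symb a n m (int j))) / (of_nat n)\<^sup>2)"
    by (simp add: char_Lambda_emp[OF n] ev_def)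
  have bound: "cmod (c k * of_real (d k)) \<le> (pi * real a / real n) * ((4 * \<bar>t\<bar>) ^ k /\<^sub>R fact k)" for k
  proof -
    have "real k \<le> 2 ^ k" using of_nat_less_two_power[of k, where 'a = real] by simp
    then have "(real k)\<^sup>2 \<le> (2 ^ k)\<^sup>2" by (intro power_mono) auto
    also have "(2 ^ k)\<^sup>2 = (4 :: real) ^ k" by (simp add: power2_eq_square flip: power_mult_distrib)
    finally have k: "(real k)\<^sup>2 \<le> 4 ^ k" .
    have "\<bar>d k\<bar> \<le> 4 ^ k * (pi * real a / real n)"
      by (rule order_trans[OF d]) (intro mult_right_mono k, simp)
    then have "\<bar>t\<bar> ^ k / fact k * \<bar>d k\<bar> \<le> \<bar>t\<bar> ^ k / fact k * (4 ^ k * (pi * real a / real n))"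
      by (intro mult_left_mono) auto
    then show ?thesis
      by (simp add: c_def norm_mult norm_power power_mult_distrib divide_inverse mult_ac)
  qed
  have dom: "(\<lambda>k. (pi * real a / real n) * ((4 * \<bar>t\<bar>) ^ k /\<^sub>R fact k)) sums ((pi * real a / real n) * exp (4 * \<bar>t\<bar>))"
    by (intro sums_mult exp_converges)
  have "cmod (\<Sum>k. c k * of_real (d k)) \<le> (\<Sum>k. (pi * real a / real n) * ((4 * \<bar>t\<bar>) ^ k /\<^sub>R fact k))"
    by (rule norm_suminf_le[OF bound]) (rule sums_summable[OF dom])
  then show ?thesis using sums_unique[OF sums] sums_unique[OF dom] by simp
qed

lemma char_half_sine_law:
  "((\<lambda>\<theta>. iexp (t * (sin \<theta> / 2))) has_integral pi * char half_sine_law t) {- (pi / 2)..pi / 2}"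
proof -
  let ?I = "{- (pi / 2)..pi / 2}"
  have "char half_sine_law t = (CLINT \<theta>|uniform_measure lborel ?I. iexp (t * (sin \<theta> / 2)))"
    unfolding char_def half_sine_law_def by (rule integral_distr) simp_all
  also have "\<dots> = (CLINT \<theta>|lborel. (indicator ?I \<theta> / pi) *\<^sub>R iexp (t * (sin \<theta> / 2)))"
  proof -
    have "uniform_measure lborel ?I = density lborel (\<lambda>\<theta>. ennreal (indicator ?I \<theta> / pi))"
      unfolding uniform_measure_def
      by (intro density_cong) (auto simp: divide_ennreal[symmetric] split: split_indicator)
    then show ?thesis by (simp add: integral_density)
  qed
  also have "\<dots> = (1 / pi) *\<^sub>R (CLINT \<theta>:?I|lborel. iexp (t * (sin \<theta> / 2)))"
    unfolding set_lebesgue_integral_def by (simp flip: integral_scaleR_right)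
  finally have "pi * char half_sine_law t = (CLINT \<theta>:?I|lborel. iexp (t * (sin \<theta> / 2)))"
    by (simp add: scaleR_conv_of_real)
  moreover have int: "set_integrable lborel ?I (\<lambda>\<theta>. iexp (t * (sin \<theta> / 2)))"
    by (intro borel_integrable_atLeastAtMost') (auto intro!: continuous_intros)
  ultimately show ?thesis
    using set_borel_integral_eq_integral[OF int] by (simp add: has_integral_iff)
qed

text \<open>
  The exponential of the symbol is a product of a function of \<open>m\<close> and a function of \<open>j\<close>, so the double
  average factors into Riemann sums of \<open>exp (i t cos (2 \<pi> b u) / 2)\<close> for \<open>b = 1\<close> and \<open>b = a\<close>. Both
  have the same limit because \<open>b u\<close> is uniform modulo 1 when \<open>u\<close> is.
\<close>
lemma char_Lambda_emp_tendsto: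
  assumes a: "a \<ge> 1"
  shows "(\<lambda>n. char (Lambda_emp n a) t) \<longlonglongrightarrow> char mu2 t"
proof -
  define N where "N = char half_sine_law t"
  define R where "R b n = (\<Sum>m<n. iexp (t * (cos (2 * pi * real b * (real m / real n)) / 2))) / of_nat n" for b n
  have R: "R b \<longlonglongrightarrow> N" if b: "b > 0" for b
    unfolding R_def
  proof (rule riemann_sum_tendsto[where L = "\<bar>t\<bar> * (pi * real b)"])
    have "continuous_on UNIV (\<lambda>s. iexp (t * (s / 2)))" by (intro continuous_intros) simp
    from has_integral_cosine_wave[OF this b char_half_sine_law]
    show "((\<lambda>u. iexp (t * (cos (2 * pi * real b * u) / 2))) has_integral N) {0..1}"
      by (simp add: N_def)
    fix x y :: real
    have "cmod (iexp (t * (cos (2 * pi * real b * x) / 2)) - iexp (t * (cos (2 * pi * real b * y) / 2)))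
      \<le> \<bar>t * (cos (2 * pi * real b * x) / 2) - t * (cos (2 * pi * real b * y) / 2)\<bar>"
      by (rule iexp_lipschitz)
    also have "\<dots> = \<bar>t\<bar> / 2 * \<bar>cos (2 * pi * real b * x) - cos (2 * pi * real b * y)\<bar>"
      by (simp add: abs_mult flip: right_diff_distrib diff_divide_distrib)
    also have "\<dots> \<le> \<bar>t\<bar> / 2 * \<bar>2 * pi * real b * x - 2 * pi * real b * y\<bar>"
      by (intro mult_left_mono abs_cos_diff_le) auto
    also have "\<dots> = \<bar>t\<bar> * (pi * real b) * \<bar>x - y\<bar>"
    proof -
      have "2 * pi * real b * x - 2 * pi * real b * y = 2 * pi * real b * (x - y)"
        by (simp add: right_diff_distrib)
      then show ?thesis by (simp add: abs_mult)
    qed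
    finally show "cmod (iexp (t * (cos (2 * pi * real b * x) / 2)) - iexp (t * (cos (2 * pi * real b * y) / 2)))
      \<le> \<bar>t\<bar> * (pi * real b) * \<bar>x - y\<bar>" .
  qed
  have prod: "(\<Sum>m<n. \<Sum>j<n. iexp (t * symb a n m (int j))) / (of_nat n)\<^sup>2 = R 1 n * R a n" for n
  proof -
    have "iexp (t * symb a n m (int j)) = iexp (t * (cos (2 * pi * real 1 * (real m / real n)) / 2))
       * iexp (t * (cos (2 * pi * real a * (real j / real n)) / 2))" for m j
      unfolding exp_add[symmetric] symb_def by (rule arg_cong[where f = exp]) (simp add: field_simps)
    then show ?thesis
      by (simp only: R_def times_divide_times_eq power2_eq_square sum_product)
  qed
  have "(\<lambda>n. char (Lambda_emp n a) t - R 1 n * R a n) \<longlonglongrightarrow> 0"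
  proof (rule Lim_null_comparison)
    show "eventually (\<lambda>n. cmod (char (Lambda_emp n a) t - R 1 n * R a n) \<le> (pi * real a * exp (4 * \<bar>t\<bar>)) * (1 / real n)) sequentially"
      using eventually_gt_at_top[of 0]
    proof eventually_elim
      case (elim n)
      show ?case using char_Lambda_emp_approx[OF elim, of a t, unfolded prod] by simp
    qed
    show "(\<lambda>n. (pi * real a * exp (4 * \<bar>t\<bar>)) * (1 / real n)) \<longlonglongrightarrow> 0"
      using tendsto_mult[OF tendsto_const lim_1_over_n] by simp
  qed
  moreover have "(\<lambda>n. R 1 n * R a n) \<longlonglongrightarrow> N * N"
    using a by (intro tendsto_mult R) auto
  ultimately have "(\<lambda>n. char (Lambda_emp n a) t - R 1 n * R a n + R 1 n * R a n) \<longlonglongrightarrow> 0 + N * N"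
    by (rule tendsto_add)
  then show ?thesis by (simp add: char_mu2 N_def power2_eq_square)
qed

section \<open>From weak convergence to Wasserstein distance\<close>

text \<open>
  The joint law of Skorohod's variables is a coupling, not necessarily an optimal one; its cost
  tends to 0 because the variables converge pointwise and are bounded by \<open>r\<close>.
\<close>
lemma d2_tendsto_0_of_weak_conv:
  fixes \<mu> :: "nat \<Rightarrow> real measure"
  assumes \<mu>: "\<And>n. real_distribution (\<mu> n)" and \<nu>: "real_distribution \<nu>" and weak: "weak_conv_m \<mu> \<nu>"
    and supp: "\<And>n. AE x in \<mu> n. \<bar>x\<bar> \<le> r" "AE x in \<nu>. \<bar>x\<bar> \<le> r"
  shows "(\<lambda>n. d2 (\<mu> n) \<nu>) \<longlonglongrightarrow> 0"
proof -
  from Skorohod[OF \<mu> \<nu> weak] obtain \<Omega> :: "real measure" and Y Z where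
    \<Omega>: "prob_space \<Omega>" and Y [measurable]: "\<And>n. Y n \<in> measurable \<Omega> borel" and dY: "\<And>n. distr \<Omega> borel (Y n) = \<mu> n"
    and Z': "Z \<in> measurable \<Omega> lborel" and dZ: "distr \<Omega> borel Z = \<nu>"
    and lim: "\<And>x. x \<in> space \<Omega> \<Longrightarrow> (\<lambda>n. Y n x) \<longlonglongrightarrow> Z x"
    by blast
  interpret prob_space \<Omega> by (rule \<Omega>)
  have Z [measurable]: "Z \<in> borel_measurable \<Omega>" using Z' by simp
  define cost where "cost n = (\<integral>\<^sup>+\<omega>. ennreal (\<bar>Y n \<omega> - Z \<omega>\<bar> ^ 2) \<partial>\<Omega>)" for n
  have Yr: "AE \<omega> in \<Omega>. \<bar>Y n \<omega>\<bar> \<le> r" for n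
    using supp(1)[of n] unfolding dY[symmetric] by (subst (asm) AE_distr_iff) auto
  have Zr: "AE \<omega> in \<Omega>. \<bar>Z \<omega>\<bar> \<le> r"
    using supp(2) unfolding dZ[symmetric] by (subst (asm) AE_distr_iff) auto
  have "(\<lambda>n. cost n) \<longlonglongrightarrow> (\<integral>\<^sup>+\<omega>. 0 \<partial>\<Omega>)"
    unfolding cost_def
  proof (rule nn_integral_dominated_convergence[where w = "\<lambda>_. ennreal ((2 * r) ^ 2)"])
    show "AE \<omega> in \<Omega>. ennreal (\<bar>Y n \<omega> - Z \<omega>\<bar> ^ 2) \<le> ennreal ((2 * r) ^ 2)" for n
      using Yr[of n] Zr
    proof eventually_elim
      case (elim \<omega>)
      then have "\<bar>Y n \<omega> - Z \<omega>\<bar> \<le> 2 * r" by linarith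
      then show ?case by (intro ennreal_leI power_mono) auto
    qed
    show "AE \<omega> in \<Omega>. (\<lambda>n. ennreal (\<bar>Y n \<omega> - Z \<omega>\<bar> ^ 2)) \<longlonglongrightarrow> 0"
    proof (rule AE_I2)
      fix \<omega> assume "\<omega> \<in> space \<Omega>"
      then have "(\<lambda>n. \<bar>Y n \<omega> - Z \<omega>\<bar> ^ 2) \<longlonglongrightarrow> \<bar>Z \<omega> - Z \<omega>\<bar> ^ 2"
        by (intro tendsto_intros lim)
      then show "(\<lambda>n. ennreal (\<bar>Y n \<omega> - Z \<omega>\<bar> ^ 2)) \<longlonglongrightarrow> 0"
        by (intro tendsto_ennrealI[of _ 0, simplified]) simp
    qed
  qed (auto simp: emeasure_space_1)
  then have cost0: "cost \<longlonglongrightarrow> 0" by simp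
  define opt where "opt n = (INF \<gamma>\<in>couplings (\<mu> n) \<nu>. \<integral>\<^sup>+ (w, z). ennreal (\<bar>w - z\<bar> ^ 2) \<partial>\<gamma>)" for n
  have opt_le: "opt n \<le> cost n" for n
  proof -
    define \<gamma> where "\<gamma> = distr \<Omega> (borel \<Otimes>\<^sub>M borel) (\<lambda>\<omega>. (Y n \<omega>, Z \<omega>))"
    have "\<gamma> \<in> couplings (\<mu> n) \<nu>"
      unfolding couplings_def \<gamma>_def dY[symmetric] dZ[symmetric]
      by (auto intro!: prob_space_distr simp: distr_distr o_def)
    moreover have "(\<integral>\<^sup>+ (w, z). ennreal (\<bar>w - z\<bar> ^ 2) \<partial>\<gamma>) = cost n"
      unfolding \<gamma>_def cost_def by (subst nn_integral_distr) auto
    ultimately show ?thesis unfolding opt_def by (metis INF_lower)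
  qed
  have opt0: "opt \<longlonglongrightarrow> 0"
    by (rule tendsto_sandwich[OF _ _ tendsto_const cost0]) (auto simp: opt_le)
  then have "(\<lambda>n. sqrt (enn2real (opt n))) \<longlonglongrightarrow> sqrt (enn2real 0)"
    by (intro tendsto_real_sqrt tendsto_enn2real) auto
  then have "(\<lambda>n. ennreal (sqrt (enn2real (opt n)))) \<longlonglongrightarrow> 0"
    by (intro tendsto_ennrealI[of _ 0, simplified]) simp
  moreover have "eventually (\<lambda>n. d2 (\<mu> n) \<nu> = ennreal (sqrt (enn2real (opt n)))) sequentially"
  proof -
    have "eventually (\<lambda>n. opt n < 1) sequentially" using opt0 by (rule order_tendstoD) simp
    then show ?thesis
    proof eventually_elim
      case (elim n)
      have "d2 (\<mu> n) \<nu> = ennreal_sqrt (opt n)" by (simp only: d2_def opt_def)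
      then show ?case using elim by (auto simp: ennreal_sqrt_def)
    qed
  qed
  ultimately show ?thesis by (simp add: tendsto_cong)
qed

theorem theorem6:
  fixes a :: nat
  assumes "a \<ge> 1"
  shows "(\<lambda>n. d2 (Lambda_emp n a) mu2) \<longlonglongrightarrow> 0"
proof -
  \<comment> \<open>For \<open>n = 0\<close> the empirical measure is not a probability measure, hence the shift of the index.\<close>
  have "(\<lambda>n. d2 (Lambda_emp (Suc n) a) mu2) \<longlonglongrightarrow> 0"
  proof (rule d2_tendsto_0_of_weak_conv[where r = 1])
    show dist: "real_distribution (Lambda_emp (Suc n) a)" for n
      by (rule real_distribution_Lambda_emp) simp
    show "real_distribution mu2" by (rule real_distribution_mu2)
    with dist show "weak_conv_m (\<lambda>n. Lambda_emp (Suc n) a) mu2"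
      by (intro levy_continuity LIMSEQ_Suc char_Lambda_emp_tendsto assms)
    show "AE x in Lambda_emp (Suc n) a. \<bar>x\<bar> \<le> 1" for n
    proof -
      have "\<bar>ordered_eigenvalues (M_mat (Suc n) a) ! i\<bar> \<le> 1" if "i < Suc n" for i
      proof (rule ordered_eigenvalues_bound[OF M_mat_carrier M_mat_row_sum])
        show "ordered_eigenvalues (M_mat (Suc n) a) ! i \<in> set (ordered_eigenvalues (M_mat (Suc n) a))"
          using that ordered_eigenvalues_symmetric(1)[OF M_mat_carrier M_mat_symmetric, of "Suc n" a]
          by (intro nth_mem) simp
      qed
      then show ?thesis
        unfolding Lambda_emp_def
        by (subst AE_distr_iff)
          (auto simp: measurable_def sets_uniform_count_measure space_uniform_count_measure intro!: AE_I2)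
    qed
    have "f2 \<in> borel_measurable borel" by (rule f2_measurable)
    then show "AE x in mu2. \<bar>x\<bar> \<le> 1"
      unfolding mu2_def by (subst AE_density) (simp, auto simp: f2_def)
  qed
  then show ?thesis by (rule LIMSEQ_imp_Suc)
qed

end
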